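(* Let $G$ be an $s$-$t$ DAG. The following statements are equivalent: (1) $G$ is width-stable; (2) $G$ has paths of large weight: for any non-zero flow $X\ge 0$ on $G$, there exists an $s$-$t$ path in $G|_X$ carrying $|X|/\mathrm{width}(G|_X)$ flow; (3) $G$ has no funnel subgraph with a central path.
   Context: An $s$-$t$ DAG is a directed acyclic graph $G=(V,E)$ with a unique source $s$ (no in-edges) and a unique sink $t$ (no out-edges). A flow is a function $X$ on $E$ (integer-valued) such that at every node of $V\setminus\{s,t\}$ incoming flow equals outgoing flow; $|X|$ is the total flow out of $s$. $X\le Y$ means $X(e)\le Y(e)$ for all $e\in E$. For a non-negative flow $X$ on $G$, $G|_X$ is the spanning subgraph of $G$ consisting of the edges $e$ with $X(e)\neq 0$, and $\mathrm{width}(G|_X)$ is the minimum number of $s$-$t$ paths in $G|_X$ needed to cover all edges of $G|_X$. A path $P$ carries flow $p$ if $X(e)\ge p$ for every edge $e$ of $P$. $G$ is width-stable if for any non-negative flows $X\le Y$ on $G$ it holds that $\mathrm{width}(G|_X)\le\mathrm{width}(G|_Y)$. An $s$-$t$ DAG is a funnel if every $s$-$t$ path has a private edge, i.e. an edge not contained in any other $s$-$t$ path. A funnel subgraph of $G$ is a subgraph $F$ of $G$ that is a funnel (as an $s$-$t$ DAG). A node of $F$ is forking in $F$ if its out-degree in $F$ is greater than $1$, and merging in $F$ if its in-degree in $F$ is greater than $1$. A central path of a funnel subgraph $F$ of $G$ is a path in $G$ from a node that is merging in $F$ to a node that is forking in $F$. *)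

theory Defs
  imports "Graph_Theory.Graph_Theory"
begin

text \<open>
  Parallel arcs are permitted; directed graphs without parallel arcs are the special case
  \<^locale>\<open>nomulti_digraph\<close>. Loops are excluded by acyclicity.
\<close>

definition st_dag :: "('a, 'b) pre_digraph \<Rightarrow> 'a \<Rightarrow> 'a \<Rightarrow> bool" where
  "st_dag G s t \<longleftrightarrow> fin_digraph G \<and> (\<nexists>c. pre_digraph.cycle G c) \<and>
     {v \<in> verts G. in_arcs G v = {}} = {s} \<and> {v \<in> verts G. out_arcs G v = {}} = {t}"

definition flow :: "('a, 'b) pre_digraph \<Rightarrow> 'a \<Rightarrow> 'a \<Rightarrow> ('b \<Rightarrow> int) \<Rightarrow> bool" where
  "flow G s t X \<longleftrightarrow>
     (\<forall>v \<in> verts G - {s, t}. (\<Sum>e \<in> in_arcs G v. X e) = (\<Sum>e \<in> out_arcs G v. X e))"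

text \<open>The values of \<open>X\<close> outside \<^term>\<open>arcs G\<close> never matter.\<close>

definition nonneg_flow :: "('a, 'b) pre_digraph \<Rightarrow> 'a \<Rightarrow> 'a \<Rightarrow> ('b \<Rightarrow> int) \<Rightarrow> bool" where
  "nonneg_flow G s t X \<longleftrightarrow> flow G s t X \<and> (\<forall>e \<in> arcs G. 0 \<le> X e)"

definition flow_value :: "('a, 'b) pre_digraph \<Rightarrow> 'a \<Rightarrow> ('b \<Rightarrow> int) \<Rightarrow> int" where
  "flow_value G s X = (\<Sum>e \<in> out_arcs G s. X e)"

definition flow_support :: "('a, 'b) pre_digraph \<Rightarrow> ('b \<Rightarrow> int) \<Rightarrow> ('a, 'b) pre_digraph" where
  "flow_support G X = \<lparr> verts = verts G, arcs = {e \<in> arcs G. X e \<noteq> 0}, tail = tail G, head = head G \<rparr>"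

text \<open>
  Paths are arc lists, so parallel arcs yield distinct paths. The empty set of paths covers
  a graph without arcs, whose width is therefore 0. If \<open>H\<close> is the support of a non-negative
  flow on an \<open>s\<close>-\<open>t\<close> DAG, then every arc of \<open>H\<close> lies on an \<open>s\<close>-\<open>t\<close> path of \<open>H\<close>, so a cover
  exists and the minimum is attained.
\<close>

definition st_path_cover :: "('a, 'b) pre_digraph \<Rightarrow> 'a \<Rightarrow> 'a \<Rightarrow> 'b list set \<Rightarrow> bool" where
  "st_path_cover H s t P \<longleftrightarrow>
     finite P \<and> (\<forall>p \<in> P. pre_digraph.apath H s p t) \<and> arcs H \<subseteq> (\<Union>p \<in> P. set p)"

definition width :: "('a, 'b) pre_digraph \<Rightarrow> 'a \<Rightarrow> 'a \<Rightarrow> nat" where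
  "width H s t = (LEAST k. \<exists>P. st_path_cover H s t P \<and> card P = k)"

definition width_stable :: "('a, 'b) pre_digraph \<Rightarrow> 'a \<Rightarrow> 'a \<Rightarrow> bool" where
  "width_stable G s t \<longleftrightarrow>
     (\<forall>X Y. nonneg_flow G s t X \<and> nonneg_flow G s t Y \<and> (\<forall>e \<in> arcs G. X e \<le> Y e) \<longrightarrow>
        width (flow_support G X) s t \<le> width (flow_support G Y) s t)"

definition carries :: "('b \<Rightarrow> int) \<Rightarrow> 'b list \<Rightarrow> real \<Rightarrow> bool" where
  "carries X p r \<longleftrightarrow> (\<forall>e \<in> set p. r \<le> real_of_int (X e))"

definition large_weight_paths :: "('a, 'b) pre_digraph \<Rightarrow> 'a \<Rightarrow> 'a \<Rightarrow> bool" where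
  "large_weight_paths G s t \<longleftrightarrow>
     (\<forall>X. nonneg_flow G s t X \<and> (\<exists>e \<in> arcs G. X e \<noteq> 0) \<longrightarrow>
        (\<exists>p. pre_digraph.apath (flow_support G X) s p t \<and>
           carries X p (real_of_int (flow_value G s X) / real (width (flow_support G X) s t))))"

definition funnel :: "('a, 'b) pre_digraph \<Rightarrow> 'a \<Rightarrow> 'a \<Rightarrow> bool" where
  "funnel F s t \<longleftrightarrow> st_dag F s t \<and>
     (\<forall>p. pre_digraph.apath F s p t \<longrightarrow>
        (\<exists>e \<in> set p. \<forall>q. pre_digraph.apath F s q t \<and> q \<noteq> p \<longrightarrow> e \<notin> set q))"

definition funnel_subgraph ::
  "('a, 'b) pre_digraph \<Rightarrow> ('a, 'b) pre_digraph \<Rightarrow> 'a \<Rightarrow> 'a \<Rightarrow> bool" where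
  "funnel_subgraph F G s t \<longleftrightarrow> subgraph F G \<and> funnel F s t"

definition merging :: "('a, 'b) pre_digraph \<Rightarrow> 'a \<Rightarrow> bool" where
  "merging F v \<longleftrightarrow> v \<in> verts F \<and> 1 < in_degree F v"

definition forking :: "('a, 'b) pre_digraph \<Rightarrow> 'a \<Rightarrow> bool" where
  "forking F v \<longleftrightarrow> v \<in> verts F \<and> 1 < out_degree F v"

text \<open>
  A central path runs in \<open>G\<close>, not necessarily in \<open>F\<close>.
\<close>

definition central_path ::
  "('a, 'b) pre_digraph \<Rightarrow> ('a, 'b) pre_digraph \<Rightarrow> 'b list \<Rightarrow> bool" where
  "central_path G F p \<longleftrightarrow> (\<exists>u v. merging F u \<and> forking F v \<and> pre_digraph.apath G u p v)"

end

theory Submission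
  imports Defs
begin

text \<open>
  The paths of a funnel correspond to the arcs of a cut: on the source side of the cut the funnel is
  an out-tree, on the sink side an in-tree. Conversely such a pair of trees can be grown around the
  arcs of suitable cuts, in particular around a largest antichain of arcs of the support of a flow,
  so a flow \<open>X\<close> contains a funnel with as many paths as its width. If no funnel has a central
  path, then cutting that funnel at the ancestors of its forking nodes gives an equally large
  antichain of the whole graph, and no flow above \<open>X\<close> has smaller width. If the graph is
  width-stable, then a flow without a path of large weight has a cut with too many arcs, which
  again yields a funnel that is too wide. Finally, adding a central path to a funnel saves one
  path in the cover and leaves every path light, which refutes both (1) and (2).
\<close>

section \<open>Walks and saturated arc sets\<close>

text \<open>The obstacle is that arcs of \<open>G\<close> outside a funnel, or outside the support
  of the smaller flow, can lead from behind a cut back to its front, so an antichain of a small arc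
  set may stop being one in a larger set. Two observations deal with this. A funnel is handled as an
  arc set \<open>F\<close> with a node set \<open>S\<close> that every path of \<open>F\<close>
  leaves exactly once; the number of paths does not depend on \<open>S\<close>, so a set obtained
  from a minimum flow may be exchanged for one that suits all of \<open>G\<close>. Moreover,
  multiplying a flow by a positive constant keeps its support and hence its width. Width-stability
  is therefore a statement about supports alone: if one support is contained in another, a multiple
  of the second flow dominates the first. The implications proved are (3) to (1), (1) to (2), and,
  by contraposition, (2) to (3).\<close>

lemma in_out_degree_gt_1_iff:
  assumes "fin_digraph F"
  shows "1 < in_degree F v \<longleftrightarrow> (\<exists>e \<in> in_arcs F v. \<exists>e' \<in> in_arcs F v. e \<noteq> e')"
    and "1 < out_degree F v \<longleftrightarrow> (\<exists>e \<in> out_arcs F v. \<exists>e' \<in> out_arcs F v. e \<noteq> e')"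
proof -
  interpret fin_digraph F by (fact assms)
  have "1 < card A \<longleftrightarrow> (\<exists>e \<in> A. \<exists>e' \<in> A. e \<noteq> e')" if "finite A" for A :: "'b set"
    using card_le_Suc0_iff_eq[OF that] by (auto simp: not_less[symmetric])
  then show "1 < in_degree F v \<longleftrightarrow> (\<exists>e \<in> in_arcs F v. \<exists>e' \<in> in_arcs F v. e \<noteq> e')"
    and "1 < out_degree F v \<longleftrightarrow> (\<exists>e \<in> out_arcs F v. \<exists>e' \<in> out_arcs F v. e \<noteq> e')"
    by (simp_all add: in_degree_def out_degree_def finite_in_arcs finite_out_arcs)
qed

text \<open>The sum telescopes along the walk. It is stated for arbitrary digraphs because it is
  applied both to \<open>G\<close> and to the residual graph in \<open>ex_cover_cut\<close>.\<close>

lemma (in wf_digraph) awalk_imbalance: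
  assumes "awalk u p v"
  shows "(\<Sum>e\<leftarrow>p. of_bool (tail G e = x) - of_bool (head G e = x)) =
    (of_bool (u = x) - of_bool (v = x) :: int)"
  using assms by (induction p arbitrary: u) (auto simp: awalk_simps)

locale st_dag_graph = fin_digraph G for G :: "('a, 'b) pre_digraph" (structure) +
  fixes s t :: 'a
  assumes acyclic: "awalk u p u \<Longrightarrow> p = []"
    and sources: "{v \<in> verts G. in_arcs G v = {}} = {s}"
    and sinks: "{v \<in> verts G. out_arcs G v = {}} = {t}"
begin

lemma s_in_verts [simp]: "s \<in> verts G" and t_in_verts [simp]: "t \<in> verts G"
  using sources sinks by auto

lemma head_neq_s [simp]: "e \<in> arcs G \<Longrightarrow> head G e \<noteq> s"
  using sources by (auto simp: in_arcs_def)

lemma tail_neq_t [simp]: "e \<in> arcs G \<Longrightarrow> tail G e \<noteq> t"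
  using sinks by (auto simp: out_arcs_def)

lemma awalk_imp_apath: "awalk u p v \<Longrightarrow> apath u p v"
  using awalk_not_distinct_decomp[of u p v] acyclic by (auto simp: apath_def)

lemma apath_iff_awalk: "apath u p v \<longleftrightarrow> awalk u p v"
  using awalk_imp_apath by (auto simp: apath_def)

lemma awalk_distinct: "awalk u p v \<Longrightarrow> distinct p"
  using awalk_imp_apath distinct_verts_imp_distinct by (auto simp: apath_def)

lemma awalk_antisym: "awalk u p v \<Longrightarrow> awalk v q u \<Longrightarrow> p = [] \<and> q = []"
  using acyclic[of u "p @ q"] by (metis append_is_Nil_conv awalk_appendI)

text \<open>Subgraphs are represented by arc sets, with the nodes always those of \<open>G\<close>.
  Walks in supports, funnels and their parts can then be concatenated and compared by plain
  inclusion of arc sets.\<close>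

definition walk_in :: "'b set \<Rightarrow> 'a \<Rightarrow> 'b list \<Rightarrow> 'a \<Rightarrow> bool" where
  "walk_in B u p v \<longleftrightarrow> awalk u p v \<and> set p \<subseteq> B"

lemma walk_in_Nil [simp]: "walk_in B u [] v \<longleftrightarrow> u = v \<and> u \<in> verts G"
  by (auto simp: walk_in_def awalk_simps)

lemma walk_in_Cons [simp]:
  "walk_in B u (e # p) v \<longleftrightarrow> e \<in> B \<and> e \<in> arcs G \<and> tail G e = u \<and> walk_in B (head G e) p v"
  by (auto simp: walk_in_def awalk_simps)

lemma walk_in_verts: "walk_in B u p v \<Longrightarrow> u \<in> verts G \<and> v \<in> verts G"
  unfolding walk_in_def using awalk_hd_in_verts awalk_last_in_verts by blast

lemma walk_in_append: "walk_in B u (p @ q) w \<longleftrightarrow> (\<exists>v. walk_in B u p v \<and> walk_in B v q w)"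
  by (induction p arbitrary: u) (auto dest: walk_in_verts)

lemma walk_in_mono: "walk_in B u p v \<Longrightarrow> B \<subseteq> C \<Longrightarrow> walk_in C u p v"
  by (auto simp: walk_in_def)

lemma walk_in_subset: "walk_in B u p v \<Longrightarrow> set p \<subseteq> B"
  by (simp add: walk_in_def)

lemma walk_in_restrict: "walk_in B u p v \<Longrightarrow> set p \<subseteq> C \<Longrightarrow> walk_in C u p v"
  by (simp add: walk_in_def)

lemma walk_in_antisym: "walk_in B u p v \<Longrightarrow> walk_in C v q u \<Longrightarrow> p = [] \<and> q = []"
  unfolding walk_in_def using awalk_antisym by blast

lemma walk_in_length: "walk_in B u p v \<Longrightarrow> length p < card (verts G)"
  unfolding walk_in_def using awalk_imp_apath length_apath_less by blast

lemma walk_in_unique_target: "walk_in B u p v \<Longrightarrow> walk_in C u p w \<Longrightarrow> v = w"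
  by (induction p arbitrary: u) auto

abbreviation st_path :: "'b set \<Rightarrow> 'b list \<Rightarrow> bool" where
  "st_path B p \<equiv> walk_in B s p t"

lemma finite_st_paths [simp]: "finite {p. st_path B p}"
proof (rule finite_subset)
  show "{p. st_path B p} \<subseteq> {p. apath s p t}"
    by (auto simp: walk_in_def awalk_imp_apath)
qed (rule apaths_finite)

text \<open>A local condition that, in a finite acyclic graph, amounts to every arc of
  \<open>B\<close> being reachable from \<open>s\<close> inside \<open>B\<close>. Together with its
  mirror image it says that \<open>B\<close> is a union of s-t paths.\<close>

definition back_saturated :: "'b set \<Rightarrow> bool" where
  "back_saturated B \<longleftrightarrow> B \<subseteq> arcs G \<and> (\<forall>e \<in> B. tail G e = s \<or> (\<exists>e' \<in> B. head G e' = tail G e))"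

definition forward_saturated :: "'b set \<Rightarrow> bool" where
  "forward_saturated B \<longleftrightarrow> B \<subseteq> arcs G \<and> (\<forall>e \<in> B. head G e = t \<or> (\<exists>e' \<in> B. tail G e' = head G e))"

definition saturated :: "'b set \<Rightarrow> bool" where
  "saturated B \<longleftrightarrow> back_saturated B \<and> forward_saturated B"

text \<open>Predecessor arcs are prepended until the start is \<open>s\<close>. This stops because
  walks in a DAG are shorter than the number of nodes. A nonempty walk supplies the first arc of
  \<open>B\<close> whose predecessor is needed.\<close>

lemma extend_walk_back:
  assumes "back_saturated B" "walk_in B u p v" "p \<noteq> []"
  shows "\<exists>q. walk_in B s q u"
  using assms(2,3)
proof (induction "card (verts G) - length p" arbitrary: u p rule: less_induct)
  case less
  show ?case
  proof (cases "u = s")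
    case True
    then show ?thesis by (metis walk_in_Nil s_in_verts)
  next
    case False
    from less.prems have "hd p \<in> B" "tail G (hd p) = u" by (cases p; simp)+
    with False assms(1) obtain e' where e': "e' \<in> B" "head G e' = u" "e' \<in> arcs G"
      unfolding back_saturated_def by blast
    then have w: "walk_in B (tail G e') (e' # p) v" using less.prems by simp
    have "length p < card (verts G)" using less.prems(1) by (rule walk_in_length)
    then have "card (verts G) - length (e' # p) < card (verts G) - length p" by simp
    from less.hyps[OF this w] obtain q where "walk_in B s q (tail G e')" by blast
    then have "walk_in B s (q @ [e']) u"
      using e' by (auto simp: walk_in_append)
    then show ?thesis by blast
  qed
qed

lemma extend_walk_forward:
  assumes "forward_saturated B" "walk_in B u p v" "p \<noteq> []"
  shows "\<exists>q. walk_in B v q t"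
  using assms(2,3)
proof (induction "card (verts G) - length p" arbitrary: v p rule: less_induct)
  case less
  show ?case
  proof (cases "v = t")
    case True
    then show ?thesis by (metis walk_in_Nil t_in_verts)
  next
    case False
    from less.prems(2) obtain p' e where p: "p = p' @ [e]" by (metis rev_exhaust)
    with less.prems have "e \<in> B" "head G e = v" by (auto simp: walk_in_append)
    with False assms(1) obtain e' where e': "e' \<in> B" "tail G e' = v" "e' \<in> arcs G"
      unfolding forward_saturated_def by blast
    then have w: "walk_in B u (p @ [e']) (head G e')"
      using less.prems by (auto simp: walk_in_append)
    have "length p < card (verts G)" using less.prems(1) by (rule walk_in_length)
    then have "card (verts G) - length (p @ [e']) < card (verts G) - length p" by simp
    from less.hyps[OF this w] obtain q where "walk_in B (head G e') q t" by blast
    then have "walk_in B v (e' # q) t" using e' by simp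
    then show ?thesis by blast
  qed
qed

lemma back_saturated_walk:
  assumes "back_saturated B" "e \<in> B"
  obtains p where "walk_in B s p (tail G e)"
proof -
  have "walk_in B (tail G e) [e] (head G e)"
    using assms by (auto simp: back_saturated_def)
  with extend_walk_back[OF assms(1)] that show thesis by blast
qed

lemma forward_saturated_walk:
  assumes "forward_saturated B" "e \<in> B"
  obtains p where "walk_in B (head G e) p t"
proof -
  have "walk_in B (tail G e) [e] (head G e)"
    using assms by (auto simp: forward_saturated_def)
  with extend_walk_forward[OF assms(1)] that show thesis by blast
qed

lemma st_path_through:
  assumes "walk_in B s p (tail G e)" "e \<in> B" "e \<in> arcs G" "walk_in B (head G e) q t"
  shows "st_path B (p @ e # q)"
  using assms by (auto simp: walk_in_append)

lemma saturated_st_path: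
  assumes "saturated B" "e \<in> B"
  obtains p where "st_path B p" "e \<in> set p"
proof -
  from assms have B: "back_saturated B" "forward_saturated B" "e \<in> arcs G"
    by (auto simp: saturated_def back_saturated_def)
  obtain p where "walk_in B s p (tail G e)" using back_saturated_walk[OF B(1) assms(2)] .
  moreover obtain q where "walk_in B (head G e) q t" using forward_saturated_walk[OF B(2) assms(2)] .
  ultimately have "st_path B (p @ e # q)"
    using assms(2) B(3) by (rule_tac st_path_through)
  with that[of "p @ e # q"] show thesis by simp
qed

lemma saturated_arcs: "saturated B \<Longrightarrow> B \<subseteq> arcs G"
  by (simp add: saturated_def back_saturated_def)

lemma st_path_neighbours:
  assumes "st_path B p" "e \<in> set p"
  shows "tail G e = s \<or> (\<exists>e' \<in> set p. head G e' = tail G e)"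
    and "head G e = t \<or> (\<exists>e' \<in> set p. tail G e' = head G e)"
proof -
  obtain q r where p: "p = q @ e # r" using split_list[OF assms(2)] by blast
  have q: "walk_in B s q (tail G e)" and r: "walk_in B (head G e) r t"
    using assms(1) by (auto simp: p walk_in_append)
  show "tail G e = s \<or> (\<exists>e' \<in> set p. head G e' = tail G e)"
    using q by (cases q rule: rev_cases) (auto simp: p walk_in_append)
  show "head G e = t \<or> (\<exists>e' \<in> set p. tail G e' = head G e)"
    using r by (cases r) (auto simp: p)
qed

lemma saturated_Union_st_paths:
  assumes "\<And>p. p \<in> P \<Longrightarrow> st_path B p" "B \<subseteq> arcs G"
  shows "saturated (\<Union>p \<in> P. set p)"
proof -
  have "(\<Union>p \<in> P. set p) \<subseteq> arcs G"
    using assms walk_in_subset by blast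
  then show ?thesis
    unfolding saturated_def back_saturated_def forward_saturated_def
    using st_path_neighbours[OF assms(1)] by blast
qed

text \<open>Every arc is reached by a walk from \<open>s\<close>; if \<open>s = t\<close>, that walk
  cannot take its first step, and the arc itself would leave \<open>t\<close>.\<close>

lemma arcs_empty_if_source_eq_sink:
  assumes "s = t"
  shows "arcs G = {}"
proof (rule ccontr)
  assume "arcs G \<noteq> {}"
  then obtain e where e: "e \<in> arcs G" by blast
  have "back_saturated (arcs G)"
    unfolding back_saturated_def
  proof (intro conjI ballI)
    fix e assume "e \<in> arcs G"
    then have "tail G e \<in> verts G" by simp
    then show "tail G e = s \<or> (\<exists>e' \<in> arcs G. head G e' = tail G e)"
      using sources unfolding in_arcs_def by blast
  qed simp
  from back_saturated_walk[OF this e] obtain p where p: "walk_in (arcs G) s p (tail G e)" .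
  show False
    using p assms tail_neq_t e by (cases p) (auto simp del: tail_neq_t)
qed

end

lemma st_dag_graphI:
  assumes "st_dag G s t"
  shows "st_dag_graph G s t"
proof -
  interpret fin_digraph G using assms by (simp add: st_dag_def)
  show ?thesis
  proof unfold_locales
    fix u p assume "awalk u p u"
    then show "p = []"
      using assms closed_w_imp_cycle[of p] by (auto simp: st_dag_def closed_w_def)
  qed (use assms in \<open>auto simp: st_dag_def\<close>)
qed

text \<open>With \<open>s = t\<close> the empty walk would be an s-t path and a path would no longer
  contribute one unit of value. That degenerate case is settled separately in the final
  theorem.\<close>

locale two_terminal_dag = st_dag_graph +
  assumes s_neq_t: "s \<noteq> t"
begin

lemma st_path_nonempty: "st_path B p \<Longrightarrow> p \<noteq> []"
  using s_neq_t by auto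

end

section \<open>Flows and widths\<close>

context two_terminal_dag
begin

text \<open>Net outflow, written as one sum over all arcs so that it is visibly linear in
  \<open>f\<close>. Conservation and flow value of every constructed flow are computed through
  it.\<close>

definition balance :: "('b \<Rightarrow> int) \<Rightarrow> 'a \<Rightarrow> int" where
  "balance f v = (\<Sum>e \<in> arcs G. f e * (of_bool (tail G e = v) - of_bool (head G e = v)))"

lemma balance_eq: "balance f v = (\<Sum>e \<in> out_arcs G v. f e) - (\<Sum>e \<in> in_arcs G v. f e)"
proof -
  have "(\<Sum>e \<in> arcs G. f e * of_bool (tail G e = v)) = (\<Sum>e \<in> out_arcs G v. f e)"
    and "(\<Sum>e \<in> arcs G. f e * of_bool (head G e = v)) = (\<Sum>e \<in> in_arcs G v. f e)"
    by (auto intro!: sum.mono_neutral_cong_right simp: out_arcs_def in_arcs_def)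
  then show ?thesis by (simp add: balance_def right_diff_distrib sum_subtractf)
qed

lemma flow_iff_balance: "flow G s t f \<longleftrightarrow> (\<forall>v \<in> verts G - {s, t}. balance f v = 0)"
  unfolding flow_def balance_eq by (intro ball_cong) auto

lemma flow_value_eq_balance: "flow_value G s f = balance f s"
proof -
  have "in_arcs G s = {}" by (auto simp: in_arcs_def)
  then show ?thesis by (simp add: flow_value_def balance_eq)
qed

lemma balance_add: "balance (\<lambda>e. f e + g e) v = balance f v + balance g v"
  by (simp add: balance_def sum.distrib distrib_right)

lemma balance_diff: "balance (\<lambda>e. f e - g e) v = balance f v - balance g v"
  by (simp add: balance_def sum_subtractf left_diff_distrib)

lemma balance_scale: "balance (\<lambda>e. c * f e) v = c * balance f v"
  by (simp add: balance_def sum_distrib_left mult.assoc)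

lemma balance_sum: "balance (\<lambda>e. \<Sum>i \<in> I. f i e) v = (\<Sum>i \<in> I. balance (f i) v)"
  unfolding balance_def by (simp add: sum_distrib_right) (rule sum.swap)

definition path_flow :: "'b list \<Rightarrow> 'b \<Rightarrow> int" where
  "path_flow p e = of_bool (e \<in> set p)"

lemma balance_path_flow:
  assumes "walk_in B u p v"
  shows "balance (path_flow p) x = of_bool (u = x) - of_bool (v = x)"
proof -
  from assms have p: "awalk u p v" by (simp add: walk_in_def)
  then have "set p \<subseteq> arcs G" by auto
  have "balance (path_flow p) x = (\<Sum>e \<in> set p. of_bool (tail G e = x) - of_bool (head G e = x))"
    unfolding balance_def path_flow_def
    using \<open>set p \<subseteq> arcs G\<close> by (intro sum.mono_neutral_cong_right) auto
  also have "\<dots> = (\<Sum>e\<leftarrow>p. of_bool (tail G e = x) - of_bool (head G e = x))"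
    using awalk_distinct[OF p] by (simp add: sum_list_distinct_conv_sum_set)
  finally show ?thesis using awalk_imbalance[OF p] by simp
qed

definition paths_flow :: "'b list set \<Rightarrow> 'b \<Rightarrow> int" where
  "paths_flow P e = (\<Sum>p \<in> P. path_flow p e)"

lemma balance_paths_flow:
  assumes "\<And>p. p \<in> P \<Longrightarrow> st_path B p"
  shows "balance (paths_flow P) x = int (card P) * (of_bool (s = x) - of_bool (t = x))"
proof -
  have "balance (paths_flow P) x = (\<Sum>p \<in> P. balance (path_flow p) x)"
    using balance_sum[of path_flow P x] by (simp add: paths_flow_def[abs_def])
  also have "\<dots> = (\<Sum>p \<in> P. of_bool (s = x) - of_bool (t = x))"
    by (intro sum.cong refl balance_path_flow[OF assms])
  finally show ?thesis by simp
qed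

lemma paths_flow_nonneg [simp]: "0 \<le> paths_flow P e"
  by (simp add: paths_flow_def path_flow_def sum_nonneg)

lemma paths_flow_ge_1: "finite P \<Longrightarrow> p \<in> P \<Longrightarrow> e \<in> set p \<Longrightarrow> 1 \<le> paths_flow P e"
  unfolding paths_flow_def
  using member_le_sum[of p P "\<lambda>p. path_flow p e"] by (simp add: path_flow_def)

lemma paths_flow_eq_0: "(\<And>p. p \<in> P \<Longrightarrow> e \<notin> set p) \<Longrightarrow> paths_flow P e = 0"
  by (simp add: paths_flow_def path_flow_def)

lemma paths_flow_le: "paths_flow P e \<le> int (card P)"
  unfolding paths_flow_def using sum_bounded_above[of P "\<lambda>p. path_flow p e" 1]
  by (simp add: path_flow_def)

definition supp :: "('b \<Rightarrow> int) \<Rightarrow> 'b set" where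
  "supp f = {e \<in> arcs G. f e \<noteq> 0}"

lemma supp_paths_flow:
  assumes "finite P" "\<And>p. p \<in> P \<Longrightarrow> set p \<subseteq> arcs G"
  shows "supp (paths_flow P) = (\<Union>p \<in> P. set p)"
proof (intro equalityI subsetI)
  fix e assume "e \<in> supp (paths_flow P)"
  then show "e \<in> (\<Union>p \<in> P. set p)"
    using paths_flow_eq_0[of P e] by (auto simp: supp_def)
next
  fix e assume "e \<in> (\<Union>p \<in> P. set p)"
  then obtain p where "p \<in> P" "e \<in> set p" by blast
  then show "e \<in> supp (paths_flow P)"
    using paths_flow_ge_1[OF assms(1), of p e] assms(2) by (auto simp: supp_def)
qed

text \<open>For non-negative values a sum vanishes only if all its terms do, so conservation says
  that an inner node has an incoming support arc if and only if it has an outgoing one.\<close>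

lemma saturated_supp:
  assumes "nonneg_flow G s t f"
  shows "saturated (supp f)"
proof -
  have f: "\<And>e. e \<in> arcs G \<Longrightarrow> 0 \<le> f e"
    and eq: "\<And>v. v \<in> verts G \<Longrightarrow> v \<noteq> s \<Longrightarrow> v \<noteq> t \<Longrightarrow>
      (\<Sum>e \<in> in_arcs G v. f e) = (\<Sum>e \<in> out_arcs G v. f e)"
    using assms by (auto simp: nonneg_flow_def flow_def)
  have zero_in: "(\<Sum>e \<in> in_arcs G v. f e) = 0 \<longleftrightarrow> (\<forall>e \<in> in_arcs G v. f e = 0)" for v
    using f by (intro sum_nonneg_eq_0_iff) (auto simp: in_arcs_def)
  have zero_out: "(\<Sum>e \<in> out_arcs G v. f e) = 0 \<longleftrightarrow> (\<forall>e \<in> out_arcs G v. f e = 0)" for v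
    using f by (intro sum_nonneg_eq_0_iff) (auto simp: out_arcs_def)
  have iff: "(\<exists>e \<in> supp f. head G e = v) \<longleftrightarrow> (\<exists>e \<in> supp f. tail G e = v)"
    if "v \<in> verts G" "v \<noteq> s" "v \<noteq> t" for v
  proof -
    have "(\<forall>e \<in> in_arcs G v. f e = 0) \<longleftrightarrow> (\<forall>e \<in> out_arcs G v. f e = 0)"
      using eq[OF that] zero_in[of v] zero_out[of v] by simp
    then show ?thesis by (auto simp: supp_def in_arcs_def out_arcs_def)
  qed
  show ?thesis
    unfolding saturated_def back_saturated_def forward_saturated_def
  proof (intro conjI ballI)
    fix e assume e: "e \<in> supp f"
    then have a: "e \<in> arcs G" by (simp add: supp_def)
    show "tail G e = s \<or> (\<exists>e' \<in> supp f. head G e' = tail G e)"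
      using iff[of "tail G e"] e a by auto
    show "head G e = t \<or> (\<exists>e' \<in> supp f. tail G e' = head G e)"
      using iff[of "head G e"] e a by auto
  qed (auto simp: supp_def)
qed

definition cut :: "'b set \<Rightarrow> 'a set \<Rightarrow> 'b set" where
  "cut B S = {e \<in> B. tail G e \<in> S \<and> head G e \<notin> S}"

text \<open>Sum the balances over \<open>S\<close>: only \<open>s\<close> contributes, and arcs
  inside \<open>S\<close> cancel. Arcs entering \<open>S\<close> are kept as a separate term, since
  the cut used for (2) may have some that carry flow.\<close>

lemma flow_value_cut:
  assumes "flow G s t f" "S \<subseteq> verts G" "s \<in> S" "t \<notin> S"
  shows "flow_value G s f =
    (\<Sum>e \<in> cut (arcs G) S. f e) - (\<Sum>e \<in> {e \<in> arcs G. tail G e \<notin> S \<and> head G e \<in> S}. f e)"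
proof -
  have fin: "finite S" using assms(2) finite_verts finite_subset by blast
  have "(\<Sum>v \<in> S. balance f v) = balance f s + (\<Sum>v \<in> S - {s}. balance f v)"
    using fin assms(3) by (simp add: sum.remove)
  also have "(\<Sum>v \<in> S - {s}. balance f v) = 0"
    using assms by (intro sum.neutral) (auto simp: flow_iff_balance)
  finally have "flow_value G s f = (\<Sum>v \<in> S. balance f v)"
    by (simp add: flow_value_eq_balance)
  also have "\<dots> = (\<Sum>e \<in> arcs G. \<Sum>v \<in> S. f e * (of_bool (tail G e = v) - of_bool (head G e = v)))"
    unfolding balance_def by (rule sum.swap)
  also have "\<dots> = (\<Sum>e \<in> arcs G. f e * (of_bool (tail G e \<in> S) - of_bool (head G e \<in> S)))"
  proof (rule sum.cong[OF refl])
    fix e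
    have "(\<Sum>v \<in> S. of_bool (x = v)) = (of_bool (x \<in> S) :: int)" for x
      using fin by (auto simp: of_bool_def)
    then show "(\<Sum>v \<in> S. f e * (of_bool (tail G e = v) - of_bool (head G e = v))) =
      f e * (of_bool (tail G e \<in> S) - of_bool (head G e \<in> S))"
      by (simp add: sum_distrib_left[symmetric] sum_subtractf)
  qed
  also have "\<dots> = (\<Sum>e \<in> arcs G. (if tail G e \<in> S \<and> head G e \<notin> S then f e else 0) -
      (if tail G e \<notin> S \<and> head G e \<in> S then f e else 0))"
    by (intro sum.cong) auto
  also have "\<dots> = (\<Sum>e \<in> cut (arcs G) S. f e) -
      (\<Sum>e \<in> {e \<in> arcs G. tail G e \<notin> S \<and> head G e \<in> S}. f e)"
    by (simp add: sum_subtractf cut_def sum.inter_filter)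
  finally show ?thesis .
qed

lemma flow_value_nonneg: "nonneg_flow G s t f \<Longrightarrow> 0 \<le> flow_value G s f"
  unfolding nonneg_flow_def flow_value_def by (auto intro: sum_nonneg)

definition cover :: "'b set \<Rightarrow> 'b list set \<Rightarrow> bool" where
  "cover B P \<longleftrightarrow> finite P \<and> (\<forall>p \<in> P. st_path B p) \<and> B \<subseteq> (\<Union>p \<in> P. set p)"

text \<open>Peeling off one s-t path of the support lowers the value by one. Only an inequality
  results because \<open>P\<close> is a set and the same path may be peeled off repeatedly.\<close>

lemma flow_decomposition:
  assumes "nonneg_flow G s t f"
  shows "\<exists>P. cover (supp f) P \<and> int (card P) \<le> flow_value G s f"
  using assms
proof (induction "nat (flow_value G s f)" arbitrary: f rule: less_induct)
  case less
  show ?case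
  proof (cases "supp f = {}")
    case True
    then show ?thesis
      using flow_value_nonneg[OF less.prems] by (intro exI[of _ "{}"]) (auto simp: cover_def)
  next
    case False
    then obtain p where p: "st_path (supp f) p"
      using saturated_st_path[OF saturated_supp[OF less.prems]] by blast
    define g where "g e = f e - path_flow p e" for e
    have bal: "balance g x = balance f x - (of_bool (s = x) - of_bool (t = x))" for x
      using balance_diff[of f "path_flow p" x] balance_path_flow[OF p, of x]
      by (simp add: g_def[abs_def])
    have nn: "nonneg_flow G s t g"
      using less.prems bal walk_in_subset[OF p]
      by (auto simp: nonneg_flow_def flow_iff_balance g_def path_flow_def supp_def subset_iff
          of_bool_def int_one_le_iff_zero_less order_less_le)
    have val: "flow_value G s g = flow_value G s f - 1"
      using bal s_neq_t by (simp add: flow_value_eq_balance)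
    with flow_value_nonneg[OF nn] have "nat (flow_value G s g) < nat (flow_value G s f)"
      by linarith
    from less.hyps[OF this nn] obtain P
      where P: "cover (supp g) P" "int (card P) \<le> flow_value G s g" by blast
    have sub: "supp g \<subseteq> supp f"
      using walk_in_subset[OF p] by (auto simp: supp_def g_def path_flow_def)
    have "supp f \<subseteq> supp g \<union> set p"
      by (auto simp: supp_def g_def path_flow_def)
    with P(1) p have "cover (supp f) (insert p P)"
      unfolding cover_def using walk_in_mono[OF _ sub] by blast
    moreover have "int (card (insert p P)) \<le> flow_value G s f"
      using P val by (simp add: card_insert_if cover_def)
    ultimately show ?thesis by blast
  qed
qed

lemma nonneg_flow_paths_flow:
  assumes "\<And>p. p \<in> P \<Longrightarrow> st_path B p"
  shows "nonneg_flow G s t (paths_flow P)" and "flow_value G s (paths_flow P) = int (card P)"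
  using balance_paths_flow[of P B, OF assms] s_neq_t
  by (auto simp: nonneg_flow_def flow_iff_balance flow_value_eq_balance)

section \<open>Path covers of supports and bounds on their width\<close>

lemma apath_flow_support_iff:
  "pre_digraph.apath (flow_support G f) u p v \<longleftrightarrow> walk_in (supp f) u p v"
proof -
  have c: "compatible G (flow_support G f)"
    by (simp add: compatible_def flow_support_def)
  have "pre_digraph.awalk (flow_support G f) u p v \<longleftrightarrow> walk_in (supp f) u p v"
    by (auto simp: pre_digraph.awalk_def walk_in_def flow_support_def supp_def
        compatible_cas[OF c, unfolded flow_support_def])
  then show ?thesis
    unfolding pre_digraph.apath_def compatible_awalk_verts[OF c, symmetric]
    using awalk_imp_apath by (auto simp: walk_in_def apath_def)
qed

lemma st_path_cover_iff: "st_path_cover (flow_support G f) s t P \<longleftrightarrow> cover (supp f) P"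
  unfolding st_path_cover_def cover_def apath_flow_support_iff
  by (simp add: flow_support_def supp_def)

lemma width_le_card: "cover (supp f) P \<Longrightarrow> width (flow_support G f) s t \<le> card P"
  unfolding width_def st_path_cover_iff by (intro Least_le) blast

lemma width_attained:
  assumes "nonneg_flow G s t f"
  obtains P where "cover (supp f) P" "card P = width (flow_support G f) s t"
proof -
  have "\<exists>k P. cover (supp f) P \<and> card P = k"
    using flow_decomposition[OF assms] by blast
  from LeastI_ex[OF this] that show thesis
    unfolding width_def st_path_cover_iff by blast
qed

text \<open>The easy half of Dilworth's theorem: each path of a cover accounts for at most one arc
  of the antichain \<open>A\<close>.\<close>

lemma card_le_width:
  assumes "nonneg_flow G s t f" "A \<subseteq> supp f"
    and "\<And>p e e'. st_path (supp f) p \<Longrightarrow> e \<in> A \<inter> set p \<Longrightarrow> e' \<in> A \<inter> set p \<Longrightarrow> e = e'"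
  shows "card A \<le> width (flow_support G f) s t"
proof -
  obtain P where P: "cover (supp f) P" and w: "card P = width (flow_support G f) s t"
    using width_attained[OF assms(1)] .
  have "A = (\<Union>p \<in> P. A \<inter> set p)"
    using P assms(2) by (auto simp: cover_def)
  also have "card \<dots> \<le> (\<Sum>p \<in> P. card (A \<inter> set p))"
    using P by (intro card_UN_le) (simp add: cover_def)
  also have "\<dots> \<le> (\<Sum>p \<in> P. 1)"
  proof (rule sum_mono)
    fix p assume "p \<in> P"
    then show "card (A \<inter> set p) \<le> 1"
      using P assms(3)[of p] card_le_Suc0_iff_eq[of "A \<inter> set p"] by (auto simp: cover_def)
  qed
  finally show ?thesis using w by simp
qed

text \<open>No arc of \<open>B\<close> enters \<open>S\<close> from outside, so a walk that has left
  \<open>S\<close> never returns.\<close>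

lemma cut_unique:
  assumes "walk_in B u p v" "\<And>e. e \<in> B \<Longrightarrow> head G e \<in> S \<Longrightarrow> tail G e \<in> S"
    and "e \<in> cut B S \<inter> set p" "e' \<in> cut B S \<inter> set p"
  shows "e = e'"
proof -
  have stay: "set p \<inter> cut B S = {}" if "walk_in B u p v" "u \<notin> S" for u p
    using that assms(2) by (induction p arbitrary: u) (auto simp: cut_def)
  show ?thesis
    using assms(1,3,4)
  proof (induction p arbitrary: u)
    case (Cons a p)
    then show ?case using stay[of "head G a" p] by (auto simp: cut_def)
  qed simp
qed

lemma cut_nonempty:
  assumes "walk_in B u p v" "u \<in> S" "v \<notin> S"
  shows "cut B S \<inter> set p \<noteq> {}"
  using assms by (induction p arbitrary: u) (auto simp: cut_def)

end

section \<open>Arc sets split into an out-tree and an in-tree\<close>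

context two_terminal_dag
begin

text \<open>A certificate that \<open>F\<close> is a funnel: the arc at which an s-t path leaves
  \<open>S\<close> determines the path in both directions, so this arc is private.\<close>

definition splits :: "'b set \<Rightarrow> 'a set \<Rightarrow> bool" where
  "splits F S \<longleftrightarrow> s \<in> S \<and> t \<notin> S \<and> (\<forall>e \<in> F. head G e \<in> S \<longrightarrow> tail G e \<in> S) \<and>
     (\<forall>e \<in> F. \<forall>e' \<in> F. head G e = head G e' \<and> head G e \<in> S \<longrightarrow> e = e') \<and>
     (\<forall>e \<in> F. \<forall>e' \<in> F. tail G e = tail G e' \<and> tail G e \<notin> S \<longrightarrow> e = e')"

lemma splitsD:
  assumes "splits F S"
  shows "s \<in> S" "t \<notin> S" "e \<in> F \<Longrightarrow> head G e \<in> S \<Longrightarrow> tail G e \<in> S"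
    and "e \<in> F \<Longrightarrow> e' \<in> F \<Longrightarrow> head G e = head G e' \<Longrightarrow> head G e \<in> S \<Longrightarrow> e = e'"
    and "e \<in> F \<Longrightarrow> e' \<in> F \<Longrightarrow> tail G e = tail G e' \<Longrightarrow> tail G e \<notin> S \<Longrightarrow> e = e'"
  using assms unfolding splits_def by blast+

lemma splits_prefix_unique:
  assumes "splits F S" "walk_in F s p v" "walk_in F s q v" "v \<in> S"
  shows "p = q"
  using assms(2-4)
proof (induction p arbitrary: v q rule: rev_induct)
  case Nil
  show ?case
  proof (cases q rule: rev_cases)
    case (snoc q' e)
    with Nil have "e \<in> arcs G" "head G e = s" by (auto simp: walk_in_append)
    then show ?thesis by simp
  qed simp
next
  case (snoc e p)
  then have e: "e \<in> F" "e \<in> arcs G" "head G e = v" "walk_in F s p (tail G e)"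
    by (auto simp: walk_in_append)
  show ?case
  proof (cases q rule: rev_cases)
    case Nil
    with snoc.prems e have "head G e = s" by simp
    with head_neq_s[OF e(2)] show ?thesis by simp
  next
    case (snoc q' e')
    with \<open>walk_in F s q v\<close> have e': "e' \<in> F" "head G e' = v" "walk_in F s q' (tail G e')"
      by (auto simp: walk_in_append)
    have "e = e'" using splitsD(4)[OF assms(1) e(1) e'(1)] e e' \<open>v \<in> S\<close> by simp
    moreover have "tail G e \<in> S" using splitsD(3)[OF assms(1) e(1)] e \<open>v \<in> S\<close> by simp
    ultimately show ?thesis using snoc.IH e(4) e'(3) snoc by simp
  qed
qed

lemma splits_suffix_unique:
  assumes "splits F S" "walk_in F v p t" "walk_in F v q t" "v \<notin> S"
  shows "p = q"
  using assms(2-4)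
proof (induction p arbitrary: v q)
  case Nil
  show ?case
  proof (cases q)
    case (Cons e q')
    with Nil have "e \<in> arcs G" "tail G e = t" by auto
    then show ?thesis by simp
  qed simp
next
  case (Cons e p)
  then have e: "e \<in> F" "e \<in> arcs G" "tail G e = v" by auto
  show ?case
  proof (cases q)
    case Nil
    with Cons.prems e have "tail G e = t" by simp
    with tail_neq_t[OF e(2)] show ?thesis by simp
  next
    case (Cons e' q')
    with \<open>walk_in F v q t\<close> have e': "e' \<in> F" "tail G e' = v" by auto
    have "e = e'" using splitsD(5)[OF assms(1) e(1) e'(1)] e e' \<open>v \<notin> S\<close> by simp
    moreover have "head G e \<notin> S" using splitsD(3)[OF assms(1) e(1)] e \<open>v \<notin> S\<close> by auto
    ultimately show ?thesis using Cons.IH[of "head G e" q'] Cons Cons.prems by simp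
  qed
qed

lemma splits_path_unique:
  assumes "splits F S" "st_path F p" "st_path F q" "e \<in> cut F S" "e \<in> set p" "e \<in> set q"
  shows "p = q"
proof -
  obtain p1 p2 where p: "p = p1 @ e # p2" using split_list[OF assms(5)] by blast
  obtain q1 q2 where q: "q = q1 @ e # q2" using split_list[OF assms(6)] by blast
  have "p1 = q1"
    using assms splits_prefix_unique[OF assms(1), of p1 "tail G e" q1]
    by (auto simp: p q walk_in_append cut_def)
  moreover have "p2 = q2"
    using assms splits_suffix_unique[OF assms(1), of "head G e" p2 q2]
    by (auto simp: p q walk_in_append cut_def)
  ultimately show ?thesis by (simp add: p q)
qed

definition private_arcs :: "'b set \<Rightarrow> bool" where
  "private_arcs B \<longleftrightarrow>
     (\<forall>p. st_path B p \<longrightarrow> (\<exists>e \<in> set p. \<forall>q. st_path B q \<and> q \<noteq> p \<longrightarrow> e \<notin> set q))"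

lemma splits_private_arcs:
  assumes "splits F S"
  shows "private_arcs F"
  unfolding private_arcs_def
proof (intro allI impI)
  fix p assume "st_path F p"
  then show "\<exists>e \<in> set p. \<forall>q. st_path F q \<and> q \<noteq> p \<longrightarrow> e \<notin> set q"
    using cut_nonempty[of F s p t S] splitsD(1,2)[OF assms] splits_path_unique[OF assms] by blast
qed

text \<open>The left-hand side does not mention \<open>S\<close>; hence all sets that split the same
  \<open>F\<close> have cuts of equal size. This is what allows one such set to be exchanged for
  another.\<close>

lemma card_st_paths_splits:
  assumes "splits F S" "saturated F"
  shows "card {p. st_path F p} = card (cut F S)"
proof -
  have "\<exists>e. e \<in> cut F S \<inter> set p" if "st_path F p" for p
    using cut_nonempty[OF that, of S] splitsD(1,2)[OF assms(1)] by blast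
  then obtain c where c: "\<And>p. st_path F p \<Longrightarrow> c p \<in> cut F S \<inter> set p"
    by metis
  have "bij_betw c {p. st_path F p} (cut F S)"
  proof (rule bij_betw_imageI)
    show "inj_on c {p. st_path F p}"
      using c splits_path_unique[OF assms(1)] unfolding inj_on_def by (metis IntD1 IntD2 mem_Collect_eq)
    show "c ` {p. st_path F p} = cut F S"
    proof (intro equalityI subsetI)
      fix e assume e: "e \<in> cut F S"
      then obtain p where p: "st_path F p" "e \<in> set p"
        using saturated_st_path[OF assms(2), of e] by (auto simp: cut_def)
      then have "c p = e"
        using cut_unique[OF p(1) splitsD(3)[OF assms(1)]] c[OF p(1)] e by blast
      with p show "e \<in> c ` {p. st_path F p}" by blast
    qed (use c in auto)
  qed
  then show ?thesis by (rule bij_betw_same_card)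
qed

text \<open>
  Keep one arc into every node of \<open>S\<close> and one arc out of every node outside \<open>S\<close>: the paths to
  the tails of \<open>A\<close> then form an out-tree and those from the heads of \<open>A\<close> an in-tree.
\<close>

lemma ex_splits:
  assumes K1: "back_saturated K1" "A \<subseteq> K1" "\<And>e. e \<in> K1 - A \<Longrightarrow> tail G e \<in> S \<and> head G e \<in> S"
    and K2: "forward_saturated K2" "A \<subseteq> K2" "\<And>e. e \<in> K2 - A \<Longrightarrow> tail G e \<notin> S \<and> head G e \<notin> S"
    and A: "\<And>e. e \<in> A \<Longrightarrow> tail G e \<in> S \<and> head G e \<notin> S"
    and S: "s \<in> S" "t \<notin> S"
  obtains F where "F \<subseteq> K1 \<union> K2" "saturated F" "splits F S" "cut F S = A"
proof -
  define into where "into v = (SOME e. e \<in> K1 \<and> head G e = v)" for v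
  define out where "out v = (SOME e. e \<in> K2 \<and> tail G e = v)" for v
  have into: "into (head G e) \<in> K1 \<and> head G (into (head G e)) = head G e" if "e \<in> K1" for e
    unfolding into_def by (rule someI[of _ e]) (simp add: that)
  have out: "out (tail G e) \<in> K2 \<and> tail G (out (tail G e)) = tail G e" if "e \<in> K2" for e
    unfolding out_def by (rule someI[of _ e]) (simp add: that)
  define L1 where "L1 = A \<union> {e \<in> K1. head G e \<in> S \<and> into (head G e) = e}"
  define L2 where "L2 = A \<union> {e \<in> K2. tail G e \<notin> S \<and> out (tail G e) = e}"
  have L1_K1: "L1 \<subseteq> K1" and L2_K2: "L2 \<subseteq> K2" using K1(2) K2(2) by (auto simp: L1_def L2_def)
  have arcs: "K1 \<subseteq> arcs G" "K2 \<subseteq> arcs G"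
    using K1(1) K2(1) by (auto simp: back_saturated_def forward_saturated_def)
  have "back_saturated L1"
    unfolding back_saturated_def
  proof (intro conjI ballI)
    fix e assume "e \<in> L1"
    then have e: "e \<in> K1" "tail G e \<in> S" using L1_K1 A K1(3) by auto
    show "tail G e = s \<or> (\<exists>e' \<in> L1. head G e' = tail G e)"
    proof (cases "tail G e = s")
      case False
      with e K1(1) obtain e' where e': "e' \<in> K1" "head G e' = tail G e"
        by (auto simp: back_saturated_def)
      then have "into (tail G e) \<in> L1 \<and> head G (into (tail G e)) = tail G e"
        using into[of e'] e(2) by (auto simp: L1_def)
      then show ?thesis by blast
    qed simp
  qed (use L1_K1 arcs in auto)
  have "forward_saturated L2"
    unfolding forward_saturated_def
  proof (intro conjI ballI)
    fix e assume "e \<in> L2"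
    then have e: "e \<in> K2" "head G e \<notin> S" using L2_K2 A K2(3) by auto
    show "head G e = t \<or> (\<exists>e' \<in> L2. tail G e' = head G e)"
    proof (cases "head G e = t")
      case False
      with e K2(1) obtain e' where e': "e' \<in> K2" "tail G e' = head G e"
        by (auto simp: forward_saturated_def)
      then have "out (head G e) \<in> L2 \<and> tail G (out (head G e)) = head G e"
        using out[of e'] e(2) by (auto simp: L2_def)
      then show ?thesis by blast
    qed simp
  qed (use L2_K2 arcs in auto)
  \<comment> \<open>\<open>L1\<close> may contain dead ends that never reach \<open>A\<close>, and
    \<open>L2\<close> arcs that are not reachable from \<open>A\<close>. Keeping only arcs on s-t
    paths removes them, while every arc of \<open>A\<close> survives.\<close>
  define F where "F = (\<Union>p \<in> {p. st_path (L1 \<union> L2) p}. set p)"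
  have F_L: "F \<subseteq> L1 \<union> L2" unfolding F_def
  proof (rule UN_least)
    fix p assume "p \<in> {p. st_path (L1 \<union> L2) p}"
    then show "set p \<subseteq> L1 \<union> L2" by (simp add: walk_in_subset)
  qed
  have A_F: "A \<subseteq> F"
  proof
    fix e assume e: "e \<in> A"
    then have "e \<in> L1" "e \<in> L2" "e \<in> arcs G" using K1(2) arcs by (auto simp: L1_def L2_def)
    obtain p where p: "walk_in L1 s p (tail G e)"
      using back_saturated_walk[OF \<open>back_saturated L1\<close> \<open>e \<in> L1\<close>] .
    obtain q where q: "walk_in L2 (head G e) q t"
      using forward_saturated_walk[OF \<open>forward_saturated L2\<close> \<open>e \<in> L2\<close>] .
    have "st_path (L1 \<union> L2) (p @ e # q)"
      using \<open>e \<in> L1\<close> \<open>e \<in> arcs G\<close> walk_in_mono[OF p Un_upper1] walk_in_mono[OF q Un_upper2]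
      by (intro st_path_through) auto
    moreover have "e \<in> set (p @ e # q)" by simp
    ultimately show "e \<in> F" unfolding F_def by blast
  qed
  have kinds: "e \<in> A \<or> (e \<notin> A \<and> tail G e \<in> S \<and> head G e \<in> S \<and> into (head G e) = e) \<or>
      (e \<notin> A \<and> tail G e \<notin> S \<and> head G e \<notin> S \<and> out (tail G e) = e)" if "e \<in> F" for e
    using that F_L K1(3)[of e] K2(3)[of e] unfolding L1_def L2_def by blast
  have "splits F S"
    unfolding splits_def
  proof (intro conjI ballI impI)
    fix e assume "e \<in> F" "head G e \<in> S"
    then show "tail G e \<in> S" using kinds[of e] A[of e] by blast
  next
    fix e e' assume e: "e \<in> F" "e' \<in> F" "head G e = head G e' \<and> head G e \<in> S"
    then have "into (head G e) = e" "into (head G e') = e'"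
      using kinds[of e] kinds[of e'] A[of e] A[of e'] by (blast, metis)
    then show "e = e'" using e(3) by metis
  next
    fix e e' assume e: "e \<in> F" "e' \<in> F" "tail G e = tail G e' \<and> tail G e \<notin> S"
    then have "out (tail G e) = e" "out (tail G e') = e'"
      using kinds[of e] kinds[of e'] A[of e] A[of e'] by (blast, metis)
    then show "e = e'" using e(3) by metis
  qed (use S in auto)
  have "cut F S = A"
  proof (intro equalityI subsetI)
    fix e assume "e \<in> cut F S"
    then show "e \<in> A" using kinds[of e] by (auto simp: cut_def)
  next
    fix e assume "e \<in> A"
    then show "e \<in> cut F S" using A[of e] A_F by (auto simp: cut_def)
  qed
  have "saturated F"
    unfolding F_def using L1_K1 L2_K2 arcs
    by (intro saturated_Union_st_paths[of _ "L1 \<union> L2"]) auto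
  have "F \<subseteq> K1 \<union> K2" using F_L L1_K1 L2_K2 by blast
  then show thesis by (rule that) fact+
qed

lemma ex_splits_of_cut:
  assumes "saturated B" "s \<in> S" "t \<notin> S" "\<And>e. e \<in> B \<Longrightarrow> head G e \<in> S \<Longrightarrow> tail G e \<in> S"
  obtains F where "F \<subseteq> B" "saturated F" "splits F S" "cut F S = cut B S"
proof -
  have B: "back_saturated B" "forward_saturated B" using assms(1) by (auto simp: saturated_def)
  have "back_saturated {e \<in> B. tail G e \<in> S}"
    using B(1) assms(4) unfolding back_saturated_def by fastforce
  moreover have "forward_saturated {e \<in> B. head G e \<notin> S}"
    using B(2) assms(4) unfolding forward_saturated_def by fastforce
  ultimately obtain F where "F \<subseteq> {e \<in> B. tail G e \<in> S} \<union> {e \<in> B. head G e \<notin> S}"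
    "saturated F" "splits F S" "cut F S = cut B S"
    using assms by (elim ex_splits[where A = "cut B S" and S = S]) (auto simp: cut_def)
  with that[of F] show thesis by blast
qed

text \<open>
  Dilworth's theorem for arcs: take a flow of least value among those with support \<open>B\<close>, and let
  \<open>S\<close> be the nodes to which the source can push a unit back, i.e. which are reachable along arcs
  of flow at least 2 and along reversed arcs. If \<open>t\<close> were in \<open>S\<close>, the flow could be reduced.
\<close>

lemma ex_cover_cut:
  assumes B: "saturated B"
  obtains S P where "S \<subseteq> verts G" "s \<in> S" "t \<notin> S" "\<And>e. e \<in> B \<Longrightarrow> head G e \<in> S \<Longrightarrow> tail G e \<in> S"
    and "cover B P" "card P \<le> card (cut B S)"
proof -
  let ?Fl = "\<lambda>f. nonneg_flow G s t f \<and> supp f = B"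
  have B_arcs: "B \<subseteq> arcs G" using B by (rule saturated_arcs)
  \<comment> \<open>One unit along every s-t path inside \<open>B\<close> gives a flow with support
    exactly \<open>B\<close>, so the minimization below is over a nonempty set.\<close>
  have "supp (paths_flow {p. st_path B p}) = (\<Union>p \<in> {p. st_path B p}. set p)"
    using B_arcs walk_in_subset by (intro supp_paths_flow finite_st_paths) blast
  also have "\<dots> = B"
  proof (intro equalityI subsetI)
    fix e assume "e \<in> B"
    obtain p where "st_path B p" "e \<in> set p" using saturated_st_path[OF B \<open>e \<in> B\<close>] .
    then show "e \<in> (\<Union>p \<in> {p. st_path B p}. set p)" by blast
  next
    fix e assume "e \<in> (\<Union>p \<in> {p. st_path B p}. set p)"
    then show "e \<in> B" by (auto dest!: walk_in_subset)
  qed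
  finally have "?Fl (paths_flow {p. st_path B p})"
    using nonneg_flow_paths_flow(1)[of "{p. st_path B p}" B] by simp
  from ex_has_least_nat[where P = ?Fl and m = "\<lambda>f. nat (flow_value G s f)", OF this]
  obtain f where f: "nonneg_flow G s t f" "supp f = B"
    and least: "\<And>g. ?Fl g \<Longrightarrow> nat (flow_value G s f) \<le> nat (flow_value G s g)"
    by blast
  have f_ge: "1 \<le> f e" if "e \<in> B" for e
    using that f B_arcs by (auto simp: nonneg_flow_def supp_def int_one_le_iff_zero_less order_less_le)
  \<comment> \<open>The tag records the direction: traversing \<open>(e, True)\<close> will take a
    unit off \<open>e\<close>, which must leave \<open>e\<close> in the support, and
    \<open>(e, False)\<close> will add one.\<close>
  define R where "R = \<lparr> verts = verts G, arcs = {(e, fwd). e \<in> B \<and> (fwd \<longrightarrow> 2 \<le> f e)},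
    tail = (\<lambda>(e, fwd). if fwd then tail G e else head G e),
    head = (\<lambda>(e, fwd). if fwd then head G e else tail G e) \<rparr>"
  interpret R: wf_digraph R
    using B_arcs by unfold_locales (auto simp: R_def)
  define S where "S = {v. \<exists>p. R.awalk s p v}"
  have "s \<in> verts R" by (simp add: R_def)
  then have "s \<in> S" unfolding S_def by (auto simp: R.awalk_Nil_iff intro!: exI[of _ "[]"])
  have "S \<subseteq> verts G" using R.awalk_last_in_verts by (fastforce simp: S_def R_def)
  have step: "head R a \<in> S" if "a \<in> arcs R" "tail R a \<in> S" for a
  proof -
    from that(2) obtain p where "R.awalk s p (tail R a)" by (auto simp: S_def)
    then have "R.awalk s (p @ [a]) (head R a)"
      using R.arc_implies_awalk[OF that(1)] by (metis R.awalk_appendI)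
    then show ?thesis unfolding S_def by blast
  qed
  have closed: "tail G e \<in> S" if "e \<in> B" "head G e \<in> S" for e
    using step[of "(e, False)"] that by (auto simp: R_def)
  have tight: "f e = 1" if "e \<in> cut B S" for e
    using step[of "(e, True)"] f_ge[of e] that by (fastforce simp: R_def cut_def)
  have "t \<notin> S"
  proof
    assume "t \<in> S"
    \<comment> \<open>Passing to a simple path makes the arcs of \<open>p\<close> distinct, so that
      \<open>g\<close>, which records only membership in \<open>p\<close>, has the balance of the
      whole walk.\<close>
    then obtain p where "R.apath s p t"
      unfolding S_def using R.reachable_awalk R.reachable_apath by blast
    then have p: "R.awalk s p t" "distinct p"
      using R.distinct_verts_imp_distinct by (auto simp: R.apath_def)
    have p_arcs: "set p \<subseteq> arcs R" using p(1) by auto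
    define g where "g e = of_bool ((e, True) \<in> set p) - (of_bool ((e, False) \<in> set p) :: int)" for e
    have "balance g x = of_bool (s = x) - of_bool (t = x)" for x
    proof -
      define h where "h a = (of_bool (tail R a = x) - of_bool (head R a = x) :: int)" for a
      have "balance g x = (\<Sum>e \<in> arcs G. \<Sum>b \<in> UNIV. of_bool ((e, b) \<in> set p) * h (e, b))"
        unfolding balance_def
        by (intro sum.cong refl) (auto simp: UNIV_bool g_def h_def R_def algebra_simps)
      also have "\<dots> = (\<Sum>a \<in> arcs G \<times> UNIV. of_bool (a \<in> set p) * h a)"
        by (simp only: sum.cartesian_product case_prod_unfold prod.collapse)
      also have "\<dots> = (\<Sum>a \<in> set p. h a)"
        using p_arcs B_arcs by (intro sum.mono_neutral_cong_right) (auto simp: R_def)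
      also have "\<dots> = (\<Sum>a\<leftarrow>p. h a)"
        using p(2) by (simp add: sum_list_distinct_conv_sum_set)
      also have "\<dots> = of_bool (s = x) - of_bool (t = x)"
        unfolding h_def by (rule R.awalk_imbalance[OF p(1)])
      finally show ?thesis .
    qed
    then have bal: "balance (\<lambda>e. f e - g e) x = balance f x - (of_bool (s = x) - of_bool (t = x))" for x
      by (simp add: balance_diff)
    have pos: "1 \<le> f e - g e" if "e \<in> B" for e
      using f_ge[OF that] p_arcs by (auto simp: g_def R_def)
    have zero: "f e - g e = 0" if "e \<in> arcs G - B" for e
      using that f(2) p_arcs by (auto simp: g_def R_def supp_def)
    have "0 \<le> f e - g e" if "e \<in> arcs G" for e
      using that pos[of e] zero[of e] by (cases "e \<in> B") auto
    then have nn: "nonneg_flow G s t (\<lambda>e. f e - g e)"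
      using f(1) bal by (auto simp: nonneg_flow_def flow_iff_balance)
    moreover have "supp (\<lambda>e. f e - g e) = B"
      using pos zero B_arcs unfolding supp_def by force
    ultimately have "nat (flow_value G s f) \<le> nat (flow_value G s (\<lambda>e. f e - g e))"
      by (intro least) simp
    moreover have "flow_value G s (\<lambda>e. f e - g e) = flow_value G s f - 1"
      using s_neq_t by (simp add: flow_value_eq_balance bal)
    ultimately show False using flow_value_nonneg[OF nn] by linarith
  qed
  \<comment> \<open>No support arc enters \<open>S\<close> and each one leaving it carries exactly
    one unit. The least value is thus the size of the cut, and decomposing \<open>f\<close> yields a
    cover of at most that size.\<close>
  have "flow_value G s f = (\<Sum>e \<in> cut (arcs G) S. f e) -
      (\<Sum>e \<in> {e \<in> arcs G. tail G e \<notin> S \<and> head G e \<in> S}. f e)"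
    using f(1) \<open>S \<subseteq> verts G\<close> \<open>s \<in> S\<close> \<open>t \<notin> S\<close>
    by (intro flow_value_cut) (auto simp: nonneg_flow_def)
  also have "(\<Sum>e \<in> {e \<in> arcs G. tail G e \<notin> S \<and> head G e \<in> S}. f e) = 0"
    using closed f(2) by (intro sum.neutral) (auto simp: supp_def)
  also have "(\<Sum>e \<in> cut (arcs G) S. f e) = (\<Sum>e \<in> cut B S. 1)"
    using B_arcs f(2) tight finite_subset[OF _ finite_arcs, of "cut (arcs G) S"]
    by (intro sum.mono_neutral_cong_right) (auto simp: cut_def supp_def)
  finally have val: "flow_value G s f = int (card (cut B S))" by simp
  obtain P where "cover B P" "int (card P) \<le> flow_value G s f"
    using flow_decomposition[OF f(1)] f(2) by blast
  with val that[of S P] \<open>S \<subseteq> verts G\<close> \<open>s \<in> S\<close> \<open>t \<notin> S\<close> closed show thesis by simp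
qed

end

section \<open>The equivalence\<close>

context two_terminal_dag
begin

section \<open>Funnel subgraphs as saturated arc sets with private arcs\<close>

lemma apath_subgraph_iff:
  assumes "subgraph F G"
  shows "pre_digraph.apath F u p v \<longleftrightarrow> u \<in> verts F \<and> walk_in (arcs F) u p v"
proof -
  have c: "compatible G F" and sub: "verts F \<subseteq> verts G" "arcs F \<subseteq> arcs G"
    using assms by (auto simp: subgraph_def)
  have "pre_digraph.awalk F u p v \<longleftrightarrow> u \<in> verts F \<and> walk_in (arcs F) u p v"
    unfolding pre_digraph.awalk_def walk_in_def compatible_cas[OF c, symmetric] using sub by blast
  then show ?thesis
    unfolding pre_digraph.apath_def compatible_awalk_verts[OF c, symmetric]
    using awalk_imp_apath[of u p v] by (auto simp: walk_in_def apath_def)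
qed

text \<open>A tail other than \<open>s\<close> without incoming arc of \<open>F\<close> would be a
  second source of \<open>F\<close>, and dually for heads and sinks.\<close>

lemma saturated_subgraph:
  assumes "subgraph F G" "st_dag F s t"
  shows "saturated (arcs F)"
proof -
  have sub: "arcs F \<subseteq> arcs G" "tail F = tail G" "head F = head G" and wf: "wf_digraph F"
    using assms(1) by (auto simp: subgraph_def compatible_def)
  have src: "v = s" if "v \<in> verts F" "in_arcs F v = {}" for v
    using assms(2) that by (auto simp: st_dag_def)
  have snk: "v = t" if "v \<in> verts F" "out_arcs F v = {}" for v
    using assms(2) that by (auto simp: st_dag_def)
  show ?thesis
    unfolding saturated_def back_saturated_def forward_saturated_def
  proof (intro conjI ballI)
    fix e assume e: "e \<in> arcs F"
    show "tail G e = s \<or> (\<exists>e' \<in> arcs F. head G e' = tail G e)"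
      using src[of "tail F e"] wf_digraph.tail_in_verts[OF wf e] sub by (auto simp: in_arcs_def)
    show "head G e = t \<or> (\<exists>e' \<in> arcs F. tail G e' = head G e)"
      using snk[of "head F e"] wf_digraph.head_in_verts[OF wf e] sub by (auto simp: out_arcs_def)
  qed (use sub in auto)
qed

text \<open>Only endpoints of arcs are kept as nodes: an isolated node would be an additional source
  and sink and would violate \<open>st_dag\<close>.\<close>

definition arc_subgraph :: "'b set \<Rightarrow> ('a, 'b) pre_digraph" where
  "arc_subgraph B = \<lparr> verts = tail G ` B \<union> head G ` B, arcs = B, tail = tail G, head = head G \<rparr>"

lemma funnel_arc_subgraph:
  assumes B: "saturated B" "B \<noteq> {}" and priv: "private_arcs B"
  shows "funnel_subgraph (arc_subgraph B) G s t"
proof -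
  let ?F = "arc_subgraph B"
  have B_arcs: "B \<subseteq> arcs G" using B(1) by (rule saturated_arcs)
  have "wf_digraph ?F" by unfold_locales (auto simp: arc_subgraph_def)
  then have sub: "subgraph ?F G"
    using B_arcs wf_digraph_axioms by (auto simp: subgraph_def compatible_def arc_subgraph_def)
  have "fin_digraph ?F"
    using \<open>wf_digraph ?F\<close> finite_subset[OF B_arcs finite_arcs]
    by (intro wf_digraph.fin_digraphI) (auto simp: arc_subgraph_def)
  obtain e where "e \<in> B" using B(2) by blast
  then obtain p where p: "st_path B p" using saturated_st_path[OF B(1)] by blast
  have s_in: "s \<in> verts ?F"
    using p st_path_nonempty[OF p] by (cases p) (auto simp: arc_subgraph_def)
  have t_in: "t \<in> verts ?F"
    using p st_path_nonempty[OF p] by (cases p rule: rev_cases) (auto simp: arc_subgraph_def walk_in_append)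
  have in_empty: "in_arcs ?F v = {} \<longleftrightarrow> v \<notin> head G ` B"
    and out_empty: "out_arcs ?F v = {} \<longleftrightarrow> v \<notin> tail G ` B" for v
    by (auto simp: in_arcs_def out_arcs_def arc_subgraph_def)
  have s_src: "s \<notin> head G ` B" and t_snk: "t \<notin> tail G ` B"
    using B_arcs head_neq_s tail_neq_t by (metis imageE subsetD)+
  have "st_dag ?F s t"
    unfolding st_dag_def
  proof (intro conjI)
    show "\<nexists>c. pre_digraph.cycle ?F c"
      using subgraph_cycle[OF sub] acyclic by (auto simp: cycle_def)
    show "{v \<in> verts ?F. in_arcs ?F v = {}} = {s}"
    proof (intro equalityI subsetI)
      fix v assume v: "v \<in> {v \<in> verts ?F. in_arcs ?F v = {}}"
      then have "v \<notin> head G ` B" by (simp add: in_empty)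
      moreover from this v obtain e where "e \<in> B" "v = tail G e" by (auto simp: arc_subgraph_def)
      ultimately show "v \<in> {s}"
        using B(1) unfolding saturated_def back_saturated_def by (metis image_eqI singletonI)
    next
      fix v assume "v \<in> {s}"
      then show "v \<in> {v \<in> verts ?F. in_arcs ?F v = {}}"
        using s_in s_src by (simp add: in_empty)
    qed
    show "{v \<in> verts ?F. out_arcs ?F v = {}} = {t}"
    proof (intro equalityI subsetI)
      fix v assume v: "v \<in> {v \<in> verts ?F. out_arcs ?F v = {}}"
      then have "v \<notin> tail G ` B" by (simp add: out_empty)
      moreover from this v obtain e where "e \<in> B" "v = head G e" by (auto simp: arc_subgraph_def)
      ultimately show "v \<in> {t}"
        using B(1) unfolding saturated_def forward_saturated_def by (metis image_eqI singletonI)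
    next
      fix v assume "v \<in> {t}"
      then show "v \<in> {v \<in> verts ?F. out_arcs ?F v = {}}"
        using t_in t_snk by (simp add: out_empty)
    qed
  qed fact
  moreover have "pre_digraph.apath ?F s p t \<longleftrightarrow> st_path B p" for p
    using apath_subgraph_iff[OF sub] s_in by (simp add: arc_subgraph_def)
  ultimately show ?thesis
    using sub priv by (simp add: funnel_subgraph_def funnel_def private_arcs_def)
qed

lemma merging_arc_subgraph:
  assumes "B \<subseteq> arcs G" "e \<in> B" "e' \<in> B" "e \<noteq> e'" "head G e = head G e'"
  shows "merging (arc_subgraph B) (head G e)"
proof -
  have fin: "fin_digraph (arc_subgraph B)"
    using finite_subset[OF assms(1) finite_arcs]
    by unfold_locales (auto simp: arc_subgraph_def)
  then show ?thesis
    using assms unfolding merging_def in_out_degree_gt_1_iff(1)[OF fin]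
    by (auto simp: in_arcs_def arc_subgraph_def)
qed

lemma forking_arc_subgraph_iff:
  assumes "B \<subseteq> arcs G"
  shows "forking (arc_subgraph B) v \<longleftrightarrow> (\<exists>e \<in> B. \<exists>e' \<in> B. e \<noteq> e' \<and> tail G e = v \<and> tail G e' = v)"
proof -
  have fin: "fin_digraph (arc_subgraph B)"
    using finite_subset[OF assms(1) finite_arcs]
    by unfold_locales (auto simp: arc_subgraph_def)
  then show ?thesis
    unfolding forking_def in_out_degree_gt_1_iff(2)[OF fin]
    by (auto simp: out_arcs_def arc_subgraph_def)
qed

section \<open>Funnels without central paths: (3) implies (1)\<close>

text \<open>
  Cutting the funnel at the ancestors of its forking nodes yields one arc per path, and these
  arcs form an antichain not only in the funnel but in all of \<open>G\<close>.
\<close>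

lemma splits_ancestors_of_forking:
  assumes F: "saturated F" and no_central: "\<nexists>p. central_path G (arc_subgraph F) p"
    and S: "S = insert s {v. \<exists>p w. awalk v p w \<and> forking (arc_subgraph F) w}"
  shows "splits F S"
proof -
  have F_arcs: "F \<subseteq> arcs G" using F by (rule saturated_arcs)
  note fork_iff = forking_arc_subgraph_iff[OF F_arcs]
  have "t \<notin> S"
  proof
    assume "t \<in> S"
    then obtain p w where p: "awalk t p w" and w: "forking (arc_subgraph F) w"
      using S s_neq_t by auto
    have "p = []" using p tail_neq_t by (cases p) (auto simp: awalk_Cons_iff simp del: tail_neq_t)
    with p w have "forking (arc_subgraph F) t" by (simp add: awalk_simps)
    then obtain e where "e \<in> F" "tail G e = t" unfolding fork_iff by blast
    with F_arcs show False using tail_neq_t by blast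
  qed
  moreover have "tail G e \<in> S" if e: "e \<in> F" "head G e \<in> S" for e
  proof -
    from e F_arcs obtain p w where p: "awalk (head G e) p w" "forking (arc_subgraph F) w"
      unfolding S using head_neq_s by blast
    from p(1) e F_arcs have "awalk (tail G e) (e # p) w" by (auto simp: awalk_simps)
    with p(2) show ?thesis unfolding S by blast
  qed
  \<comment> \<open>Such a common head is merging, and its walk to a forking node is a central path.
    This is where the absence of central paths enters.\<close>
  moreover have "e = e'" if e: "e \<in> F" "e' \<in> F" "head G e = head G e'" "head G e \<in> S" for e e'
  proof (rule ccontr)
    assume "e \<noteq> e'"
    with e have "merging (arc_subgraph F) (head G e)"
      by (intro merging_arc_subgraph[OF F_arcs, of e e'])
    moreover from e F_arcs obtain p w where "awalk (head G e) p w" "forking (arc_subgraph F) w"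
      unfolding S using head_neq_s by blast
    ultimately show False
      using no_central awalk_imp_apath unfolding central_path_def by blast
  qed
  moreover have "e = e'" if e: "e \<in> F" "e' \<in> F" "tail G e = tail G e'" "tail G e \<notin> S" for e e'
  proof (rule ccontr)
    assume "e \<noteq> e'"
    with e have "forking (arc_subgraph F) (tail G e)" unfolding fork_iff by metis
    moreover have "awalk (tail G e) [] (tail G e)" using e F_arcs by (auto simp: awalk_simps)
    ultimately show False using e(4) unfolding S by blast
  qed
  ultimately show ?thesis unfolding splits_def using S by blast
qed

text \<open>The set \<open>S\<close> from duality bounds the width of \<open>X\<close> from above,
  but arcs in the support of \<open>Y\<close> may enter it. It is replaced by \<open>S'\<close>,
  whose cut of \<open>F\<close> has the same size and which no arc of \<open>G\<close> enters; this
  bounds the width of \<open>Y\<close> from below.\<close>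

lemma no_central_path_imp_width_stable:
  assumes no_central: "\<nexists>F p. funnel_subgraph F G s t \<and> central_path G F p"
  shows "width_stable G s t"
  unfolding width_stable_def
proof (intro allI impI, elim conjE)
  fix X Y
  assume X: "nonneg_flow G s t X" and Y: "nonneg_flow G s t Y" and le: "\<forall>e \<in> arcs G. X e \<le> Y e"
  have supp: "supp X \<subseteq> supp Y"
    using X le by (force simp: supp_def nonneg_flow_def)
  show "width (flow_support G X) s t \<le> width (flow_support G Y) s t"
  proof (cases "supp X = {}")
    case True
    then have "cover (supp X) {}" by (simp add: cover_def)
    from width_le_card[OF this] show ?thesis by simp
  next
    case False
    have sat: "saturated (supp X)" using X by (rule saturated_supp)
    from ex_cover_cut[OF sat] obtain S P where S: "s \<in> S" "t \<notin> S"
      "\<And>e. e \<in> supp X \<Longrightarrow> head G e \<in> S \<Longrightarrow> tail G e \<in> S"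
      and P: "cover (supp X) P" "card P \<le> card (cut (supp X) S)" by metis
    from ex_splits_of_cut[OF sat S] obtain F where F: "F \<subseteq> supp X" "saturated F" "splits F S"
      "cut F S = cut (supp X) S" by metis
    obtain p where "st_path (supp X) p"
      using False saturated_st_path[OF sat] by blast
    then have "cut F S \<noteq> {}" using cut_nonempty[OF _ S(1,2)] F(4) by blast
    then have "F \<noteq> {}" by (auto simp: cut_def)
    with F have "funnel_subgraph (arc_subgraph F) G s t"
      by (intro funnel_arc_subgraph splits_private_arcs)
    with no_central have nc: "\<nexists>p. central_path G (arc_subgraph F) p" by blast
    \<comment> \<open>The walks range over all of \<open>G\<close>, which makes \<open>S'\<close>
      closed under predecessors in \<open>G\<close>. Inserting \<open>s\<close> covers the case that
      \<open>F\<close> is a single path and has no forking node.\<close>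
    define S' where "S' = insert s {v. \<exists>p w. awalk v p w \<and> forking (arc_subgraph F) w}"
    have F': "splits F S'" using F(2) nc S'_def by (rule splits_ancestors_of_forking)
    have closed: "tail G e \<in> S'" if "e \<in> arcs G" "head G e \<in> S'" for e
    proof -
      from that obtain p w where p: "awalk (head G e) p w" "forking (arc_subgraph F) w"
        unfolding S'_def using head_neq_s by blast
      from p(1) that have "awalk (tail G e) (e # p) w" by (auto simp: awalk_simps)
      with p(2) show ?thesis unfolding S'_def by blast
    qed
    have "width (flow_support G X) s t \<le> card (cut F S)"
      using width_le_card[OF P(1)] P(2) F(4) by simp
    also have "\<dots> = card (cut F S')"
      using card_st_paths_splits[OF F(3,2)] card_st_paths_splits[OF F' F(2)] by simp
    also have "\<dots> \<le> width (flow_support G Y) s t"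
    proof (rule card_le_width[OF Y])
      show "cut F S' \<subseteq> supp Y" using F(1) supp by (auto simp: cut_def)
      then have sub: "cut F S' \<subseteq> cut (supp Y) S'" by (auto simp: cut_def)
      fix p e e' assume p: "st_path (supp Y) p" and "e \<in> cut F S' \<inter> set p" "e' \<in> cut F S' \<inter> set p"
      then have e: "e \<in> cut (supp Y) S' \<inter> set p" "e' \<in> cut (supp Y) S' \<inter> set p"
        using sub by auto
      have "\<And>e. e \<in> supp Y \<Longrightarrow> head G e \<in> S' \<Longrightarrow> tail G e \<in> S'"
        using closed by (simp add: supp_def)
      from cut_unique[OF p this e] show "e = e'" .
    qed
    finally show ?thesis .
  qed
qed

section \<open>Cuts of light arcs: (1) implies (2)\<close>

text \<open>
  If every path has an arc of flow less than \<open>T = |X| / width(G|\<^sub>X)\<close>, then the arcs of flow at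
  least \<open>T\<close> do not lead from \<open>s\<close> to \<open>t\<close>, so \<open>|X|\<close> is exceeded by \<open>T\<close> times the number of arcs
  of some cut. That cut need not be an antichain in the support of \<open>X\<close>, as arcs may lead back,
  but its arcs are the private arcs of a funnel in the support, which is too wide for a
  width-stable graph.
\<close>

lemma width_stable_imp_large_weight_paths:
  assumes stable: "width_stable G s t"
  shows "large_weight_paths G s t"
  unfolding large_weight_paths_def
proof (intro allI impI, elim conjE)
  fix X assume X: "nonneg_flow G s t X" and nonzero: "\<exists>e \<in> arcs G. X e \<noteq> 0"
  define w where "w = width (flow_support G X) s t"
  define T where "T = real_of_int (flow_value G s X) / real w"
  have sat: "saturated (supp X)" using X by (rule saturated_supp)
  have supp_arcs: "supp X \<subseteq> arcs G" by (auto simp: supp_def)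
  have ge1: "1 \<le> X e" if "e \<in> supp X" for e
    using that X by (auto simp: supp_def nonneg_flow_def int_one_le_iff_zero_less order_less_le)
  have cover_pos: "0 < card P" if "cover (supp X) P" for P
    using that nonzero by (auto simp: cover_def supp_def card_gt_0_iff)
  have w_pos: "0 < w"
    using width_attained[OF X] cover_pos unfolding w_def by metis
  have val_pos: "0 < flow_value G s X"
    using flow_decomposition[OF X] cover_pos by fastforce
  show "\<exists>p. pre_digraph.apath (flow_support G X) s p t \<and>
    carries X p (real_of_int (flow_value G s X) / real (width (flow_support G X) s t))"
  proof (rule ccontr)
    assume "\<not> ?thesis"
    then have none: "\<not> (st_path (supp X) p \<and> carries X p T)" for p
      by (simp add: apath_flow_support_iff T_def w_def)
    define big where "big = {e \<in> supp X. T \<le> real_of_int (X e)}"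
    define S0 where "S0 = {v. \<exists>p. walk_in big s p v}"
    \<comment> \<open>The cut is taken at the complement of \<open>Z\<close> rather than at
      \<open>S0\<close>, because an arc leaving \<open>S0\<close> might reach \<open>t\<close> only
      by passing through \<open>S0\<close> again. Now the head of each cut arc reaches
      \<open>t\<close> within \<open>Z\<close>, and its tail still lies in \<open>S0\<close> and is
      reached from \<open>s\<close> by heavy arcs.\<close>
    define Z where "Z = {v. \<exists>p. walk_in {e \<in> supp X. tail G e \<notin> S0} v p t}"
    define S where "S = verts G - Z"
    define A where "A = cut (supp X) S"
    have big_supp: "big \<subseteq> supp X" by (auto simp: big_def)
    have "t \<notin> S0"
    proof
      assume "t \<in> S0"
      then obtain p where p: "st_path big p" by (auto simp: S0_def)
      then have "carries X p T" using walk_in_subset[OF p] by (auto simp: carries_def big_def)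
      with none walk_in_mono[OF p big_supp] show False by blast
    qed
    have "walk_in big s [] s" by simp
    then have "s \<in> S0" unfolding S0_def by blast
    have big_step: "head G e \<in> S0" if e: "e \<in> big" "tail G e \<in> S0" for e
    proof -
      from e(2) obtain p where "walk_in big s p (tail G e)" by (auto simp: S0_def)
      with e(1) have "walk_in big s (p @ [e]) (head G e)"
        using big_supp supp_arcs by (auto simp: walk_in_append)
      then show ?thesis unfolding S0_def by blast
    qed
    have S0_Z: "v \<notin> Z" if "v \<in> S0" for v
    proof
      assume "v \<in> Z"
      then obtain p where "walk_in {e \<in> supp X. tail G e \<notin> S0} v p t" by (auto simp: Z_def)
      with that \<open>t \<notin> S0\<close> show False by (cases p) auto
    qed
    have S0_S: "v \<in> S" if "v \<in> S0" for v
      using that S0_Z[OF that] walk_in_verts unfolding S_def S0_def by blast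
    have "walk_in {e \<in> supp X. tail G e \<notin> S0} t [] t" by simp
    then have "t \<in> Z" unfolding Z_def by blast
    have Z_verts: "Z \<subseteq> verts G" using walk_in_verts unfolding Z_def by blast
    have A_S0: "tail G e \<in> S0" if e: "e \<in> A" for e
    proof (rule ccontr)
      assume ns: "tail G e \<notin> S0"
      have e': "e \<in> supp X" "e \<in> arcs G" "tail G e \<notin> Z" "head G e \<in> Z"
        using e supp_arcs by (auto simp: A_def cut_def S_def)
      then obtain p where "walk_in {e \<in> supp X. tail G e \<notin> S0} (head G e) p t"
        by (auto simp: Z_def)
      with e' ns have "walk_in {e \<in> supp X. tail G e \<notin> S0} (tail G e) (e # p) t" by simp
      with e'(3) show False unfolding Z_def by blast
    qed
    have A_small: "real_of_int (X e) < T" if e: "e \<in> A" for e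
    proof (rule ccontr)
      assume "\<not> ?thesis"
      with e have "e \<in> big" by (auto simp: big_def A_def cut_def)
      from big_step[OF this A_S0[OF e]] S0_S e show False by (auto simp: A_def cut_def)
    qed
    define K1 where "K1 = A \<union> {e \<in> big. tail G e \<in> S0}"
    define K2 where "K2 = A \<union> {e \<in> supp X. tail G e \<in> Z \<and> head G e \<in> Z}"
    have K1: "back_saturated K1"
      unfolding back_saturated_def
    proof (intro conjI ballI)
      show "K1 \<subseteq> arcs G" using big_supp supp_arcs by (auto simp: K1_def A_def cut_def)
      fix e assume "e \<in> K1"
      then have "tail G e \<in> S0" using A_S0 by (auto simp: K1_def)
      then obtain p where p: "walk_in big s p (tail G e)" by (auto simp: S0_def)
      show "tail G e = s \<or> (\<exists>e' \<in> K1. head G e' = tail G e)"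
      proof (cases p rule: rev_cases)
        case Nil
        with p show ?thesis by simp
      next
        case (snoc q e')
        with p have "e' \<in> big" "walk_in big s q (tail G e')" "head G e' = tail G e"
          by (auto simp: walk_in_append)
        then show ?thesis unfolding K1_def S0_def by blast
      qed
    qed
    have K2: "forward_saturated K2"
      unfolding forward_saturated_def
    proof (intro conjI ballI)
      show "K2 \<subseteq> arcs G" using supp_arcs by (auto simp: K2_def A_def cut_def)
      fix e assume e: "e \<in> K2"
      then have "head G e \<in> Z" using supp_arcs by (auto simp: K2_def A_def cut_def S_def)
      then obtain p where p: "walk_in {e \<in> supp X. tail G e \<notin> S0} (head G e) p t"
        by (auto simp: Z_def)
      show "head G e = t \<or> (\<exists>e' \<in> K2. tail G e' = head G e)"
      proof (cases p)
        case Nil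
        with p show ?thesis by simp
      next
        case (Cons e' q)
        with p have e': "e' \<in> supp X" "tail G e' = head G e"
          "walk_in {e \<in> supp X. tail G e \<notin> S0} (head G e') q t" by auto
        then have "head G e' \<in> Z" unfolding Z_def by blast
        with e' \<open>head G e \<in> Z\<close> show ?thesis by (auto simp: K2_def)
      qed
    qed
    have K1_A: "tail G e \<in> S \<and> head G e \<in> S" if "e \<in> K1 - A" for e
      using that big_step S0_S by (auto simp: K1_def)
    have K2_A: "tail G e \<notin> S \<and> head G e \<notin> S" if "e \<in> K2 - A" for e
      using that by (auto simp: K2_def S_def)
    have "A \<subseteq> K1" "A \<subseteq> K2" by (auto simp: K1_def K2_def)
    have A_cut: "tail G e \<in> S \<and> head G e \<notin> S" if "e \<in> A" for e
      using that by (simp add: A_def cut_def)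
    have "s \<in> S" "t \<notin> S"
      using S0_S[OF \<open>s \<in> S0\<close>] \<open>t \<in> Z\<close> by (auto simp: S_def)
    from ex_splits[OF K1 \<open>A \<subseteq> K1\<close> K1_A K2 \<open>A \<subseteq> K2\<close> K2_A A_cut this]
    obtain F where F: "F \<subseteq> K1 \<union> K2" "saturated F" "splits F S" "cut F S = A" by metis
    have F_supp: "F \<subseteq> supp X" using F(1) big_supp by (auto simp: K1_def K2_def A_def cut_def)
    have fin_A: "finite A"
      using finite_subset[OF supp_arcs finite_arcs] by (simp add: A_def cut_def)
    have "flow_value G s X = (\<Sum>e \<in> cut (arcs G) S. X e) -
        (\<Sum>e \<in> {e \<in> arcs G. tail G e \<notin> S \<and> head G e \<in> S}. X e)"
      using X \<open>s \<in> S\<close> \<open>t \<notin> S\<close> by (intro flow_value_cut) (auto simp: nonneg_flow_def S_def)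
    also have "\<dots> \<le> (\<Sum>e \<in> cut (arcs G) S. X e)"
      using X by (auto simp: nonneg_flow_def intro: sum_nonneg)
    also have "\<dots> = (\<Sum>e \<in> A. X e)"
    proof (rule sum.mono_neutral_right)
      show "finite (cut (arcs G) S)" by (simp add: cut_def)
    qed (auto simp: A_def cut_def supp_def)
    finally have val_le: "flow_value G s X \<le> (\<Sum>e \<in> A. X e)" .
    with val_pos have "A \<noteq> {}" by auto
    have "real_of_int (flow_value G s X) \<le> (\<Sum>e \<in> A. real_of_int (X e))"
      using val_le by (metis of_int_le_iff of_int_sum)
    also have "\<dots> < (\<Sum>e \<in> A. T)"
      using fin_A \<open>A \<noteq> {}\<close> A_small by (intro sum_strict_mono)
    finally have "real_of_int (flow_value G s X) < real (card A) * T" by simp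
    then have "w < card A"
      using w_pos val_pos by (simp add: T_def field_simps)
    define P where "P = {p. st_path F p}"
    have P: "finite P" "\<And>p. p \<in> P \<Longrightarrow> st_path F p" by (auto simp: P_def)
    have card_P: "card P = card A"
      using card_st_paths_splits[OF F(3,2)] F(4) by (simp add: P_def)
    have "supp (paths_flow P) = (\<Union>p \<in> P. set p)"
    proof (rule supp_paths_flow[OF P(1)])
      fix p assume "p \<in> P"
      with walk_in_subset[OF P(2)] F_supp supp_arcs show "set p \<subseteq> arcs G" by blast
    qed
    also have "\<dots> = F"
    proof (intro equalityI subsetI)
      fix e assume "e \<in> F"
      from saturated_st_path[OF F(2) this] show "e \<in> (\<Union>p \<in> P. set p)"
        unfolding P_def by blast
    next
      fix e assume "e \<in> (\<Union>p \<in> P. set p)"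
      then show "e \<in> F" using walk_in_subset[OF P(2)] by blast
    qed
    finally have supp_P: "supp (paths_flow P) = F" .
    have nn_P: "nonneg_flow G s t (paths_flow P)"
      using P(2) by (rule nonneg_flow_paths_flow)
    \<comment> \<open>The factor makes \<open>Y\<close> dominate the funnel flow: on
      \<open>F\<close> one has \<open>1 \<le> X e\<close>, and \<open>card P\<close> paths put at
      most \<open>card P\<close> units on an arc. The support is that of \<open>X\<close>.\<close>
    define Y where "Y e = int (card P) * X e" for e
    have nn_Y: "nonneg_flow G s t Y"
      using X balance_scale[of "int (card P)" X]
      by (auto simp: nonneg_flow_def flow_iff_balance Y_def[abs_def])
    have le: "paths_flow P e \<le> Y e" if "e \<in> arcs G" for e
    proof (cases "e \<in> F")
      case True
      then have "1 \<le> X e" using F_supp ge1 by blast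
      then have "int (card P) * 1 \<le> int (card P) * X e" by (intro mult_left_mono) auto
      with paths_flow_le[of P e] show ?thesis by (simp add: Y_def)
    next
      case False
      then have "paths_flow P e = 0" using supp_P that by (auto simp: supp_def)
      with nn_Y that show ?thesis by (auto simp: nonneg_flow_def)
    qed
    have "flow_support G Y = flow_support G X"
      using card_P \<open>w < card A\<close> by (auto simp: flow_support_def Y_def)
    moreover have "card A \<le> width (flow_support G (paths_flow P)) s t"
    proof (rule card_le_width[OF nn_P])
      show "A \<subseteq> supp (paths_flow P)" using F(4) supp_P by (auto simp: cut_def)
      fix p e e' assume "st_path (supp (paths_flow P)) p" and "e \<in> A \<inter> set p" "e' \<in> A \<inter> set p"
      then show "e = e'"
        using cut_unique[of F s p t S e e'] splitsD(3)[OF F(3)] F(4) supp_P by simp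
    qed
    moreover have "width (flow_support G (paths_flow P)) s t \<le> width (flow_support G Y) s t"
      using stable nn_P nn_Y le unfolding width_stable_def by blast
    ultimately show False using \<open>w < card A\<close> by (simp add: w_def)
  qed
qed


section \<open>Flows built from a central path: it refutes (1) and (2)\<close>

lemma private_arcs_no_merge_fork:
  assumes priv: "private_arcs B"
    and "walk_in B s a u" "walk_in B s a' u" "a \<noteq> a'" "walk_in B u m v"
    and "walk_in B v b t" "walk_in B v b' t" "b \<noteq> b'"
  shows False
proof -
  \<comment> \<open>Each arc of \<open>a @ m @ b\<close> also lies on \<open>a' @ m @ b\<close> or
    on \<open>a @ m @ b'\<close>, so none of them is private.\<close>
  have "st_path B (a @ m @ b)" "st_path B (a' @ m @ b)" "st_path B (a @ m @ b')"
    using assms by (auto simp: walk_in_append)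
  then obtain e where "e \<in> set (a @ m @ b)"
    "\<forall>q. st_path B q \<and> q \<noteq> a @ m @ b \<longrightarrow> e \<notin> set q"
    using priv unfolding private_arcs_def by blast
  then have "e \<notin> set (a' @ m @ b)" "e \<notin> set (a @ m @ b')"
    using \<open>st_path B (a' @ m @ b)\<close> \<open>st_path B (a @ m @ b')\<close> \<open>a \<noteq> a'\<close> \<open>b \<noteq> b'\<close>
    by (metis append_same_eq, metis same_append_eq)
  with \<open>e \<in> set (a @ m @ b)\<close> show False by auto
qed

text \<open>On a common path, \<open>u\<close> before \<open>v\<close> would be a merging followed
  by a fork inside \<open>B\<close>. If \<open>v\<close> comes first, acyclicity against
  \<open>M\<close> forces \<open>u = v\<close>, which is the same situation with an empty
  connection.\<close>

lemma private_arcs_disjoint_paths: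
  assumes priv: "private_arcs B"
    and a: "walk_in B s a u" "walk_in B s a' u" "a \<noteq> a'" and c: "walk_in B u c t"
    and d: "walk_in B s d v" and b: "walk_in B v b t" "walk_in B v b' t" "b \<noteq> b'"
    and M: "walk_in C u M v"
  shows "a @ c \<noteq> d @ b"
proof
  assume "a @ c = d @ b"
  then consider m where "d = a @ m" | m where "a = d @ m"
    by (auto simp: append_eq_append_conv2)
  then show False
  proof cases
    case 1
    with d a(1) obtain w where "walk_in B s a w" "walk_in B w m v" by (auto simp: walk_in_append)
    with a(1) have "walk_in B u m v" using walk_in_unique_target by blast
    from private_arcs_no_merge_fork[OF priv a this b] show False by simp
  next
    case 2
    with d a(1) obtain w where "walk_in B s d w" "walk_in B w m u" by (auto simp: walk_in_append)
    with d have m: "walk_in B v m u" using walk_in_unique_target by blast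
    then have "m = []" using walk_in_antisym[OF m M] by simp
    with m have "walk_in B u [] v" by auto
    from private_arcs_no_merge_fork[OF priv a this b] show False by simp
  qed
qed

text \<open>
  Let \<open>a\<close>, \<open>a'\<close> be paths of the funnel into a merging node, continued by \<open>c\<close> to \<open>t\<close>, let \<open>b\<close>,
  \<open>b'\<close> be paths out of a forking node, preceded by \<open>d\<close> from \<open>s\<close>, and let \<open>M\<close> be a central path.
  In the union of the funnel and \<open>M\<close> the two paths \<open>a @ c\<close> and \<open>d @ b\<close> of a path cover can be
  replaced by the single path \<open>a @ M @ b\<close>, as \<open>c\<close> and \<open>d\<close> are covered by \<open>a' @ c\<close> and \<open>d @ b'\<close>.
  If every funnel path carries \<open>k\<close> units, where \<open>k\<close> is their number, and \<open>a @ M @ b\<close> carries one,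
  then no path carries more than \<open>k + 1 < (k * k + 1) / (k - 1)\<close>.
\<close>

lemma central_path_flows:
  assumes F: "funnel_subgraph F G s t" and central: "central_path G F M"
  obtains X Y where "nonneg_flow G s t X" "nonneg_flow G s t Y" "\<And>e. e \<in> arcs G \<Longrightarrow> X e \<le> Y e"
    and "width (flow_support G Y) s t < width (flow_support G X) s t" "\<exists>e \<in> arcs G. Y e \<noteq> 0"
    and "\<And>p. st_path (supp Y) p \<Longrightarrow>
      \<not> carries Y p (real_of_int (flow_value G s Y) / real (width (flow_support G Y) s t))"
proof -
  define B where "B = arcs F"
  define P where "P = {p. st_path B p}"
  define k where "k = card P"
  have sub: "subgraph F G" and dag: "st_dag F s t"
    and priv0: "\<And>p. pre_digraph.apath F s p t \<Longrightarrow>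
      \<exists>e \<in> set p. \<forall>q. pre_digraph.apath F s q t \<and> q \<noteq> p \<longrightarrow> e \<notin> set q"
    using F by (auto simp: funnel_subgraph_def funnel_def)
  have "s \<in> verts F" using dag by (auto simp: st_dag_def)
  then have apath_iff: "pre_digraph.apath F s p t \<longleftrightarrow> st_path B p" for p
    using apath_subgraph_iff[OF sub] by (simp add: B_def)
  have priv: "private_arcs B"
    using priv0 by (simp add: apath_iff private_arcs_def)
  have sat: "saturated B" using saturated_subgraph[OF sub dag] by (simp add: B_def)
  then have bsat: "back_saturated B" and fsat: "forward_saturated B"
    by (auto simp: saturated_def)
  have B_arcs: "B \<subseteq> arcs G" using sat by (rule saturated_arcs)
  have ends: "tail F = tail G" "head F = head G" using sub by (auto simp: subgraph_def compatible_def)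
  have "fin_digraph F" using dag by (simp add: st_dag_def)
  from central obtain u v where u: "merging F u" and v: "forking F v" and "apath u M v"
    by (auto simp: central_path_def)
  then have M: "walk_in (arcs G) u M v" by (auto simp: walk_in_def apath_iff_awalk)
  from u obtain e e' where e: "e \<in> B" "e' \<in> B" "head G e = u" "head G e' = u" "e \<noteq> e'"
    unfolding merging_def in_out_degree_gt_1_iff(1)[OF \<open>fin_digraph F\<close>]
    by (auto simp: in_arcs_def B_def ends)
  from v obtain f f' where f: "f \<in> B" "f' \<in> B" "tail G f = v" "tail G f' = v" "f \<noteq> f'"
    unfolding forking_def in_out_degree_gt_1_iff(2)[OF \<open>fin_digraph F\<close>]
    by (auto simp: out_arcs_def B_def ends)
  obtain a0 where "walk_in B s a0 (tail G e)" using back_saturated_walk[OF bsat e(1)] .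
  moreover define a where "a = a0 @ [e]"
  ultimately have a: "walk_in B s a u" using e B_arcs by (auto simp: walk_in_append)
  obtain a0' where "walk_in B s a0' (tail G e')" using back_saturated_walk[OF bsat e(2)] .
  moreover define a' where "a' = a0' @ [e']"
  ultimately have a': "walk_in B s a' u" using e B_arcs by (auto simp: walk_in_append)
  have "a \<noteq> a'" using e(5) by (simp add: a_def a'_def)
  obtain c where c: "walk_in B u c t" using forward_saturated_walk[OF fsat e(1)] e(3) by metis
  obtain b0 where "walk_in B (head G f) b0 t" using forward_saturated_walk[OF fsat f(1)] .
  moreover define b where "b = f # b0"
  ultimately have b: "walk_in B v b t" using f B_arcs by auto
  obtain b0' where "walk_in B (head G f') b0' t" using forward_saturated_walk[OF fsat f(2)] .
  moreover define b' where "b' = f' # b0'"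
  ultimately have b': "walk_in B v b' t" using f B_arcs by auto
  have "b \<noteq> b'" using f(5) by (simp add: b_def b'_def)
  obtain d where d: "walk_in B s d v" using back_saturated_walk[OF bsat f(1)] f(3) by metis
  note aa' = a a' \<open>a \<noteq> a'\<close> and a'a = a' a \<open>a \<noteq> a'\<close>[symmetric]
    and bb' = b b' \<open>b \<noteq> b'\<close> and b'b = b' b \<open>b \<noteq> b'\<close>[symmetric]
  note disj = private_arcs_disjoint_paths[OF priv]
  \<comment> \<open>The first inequality ensures that two paths are really saved; the other two keep
    \<open>a' @ c\<close> and \<open>d @ b'\<close> among the remaining ones.\<close>
  have neq: "a @ c \<noteq> d @ b" "a' @ c \<noteq> d @ b" "a @ c \<noteq> d @ b'"
    using disj[OF aa' c d bb' M] disj[OF a'a c d bb' M] disj[OF aa' c d b'b M] by simp_all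
  have in_P: "a @ c \<in> P" "a' @ c \<in> P" "d @ b \<in> P" "d @ b' \<in> P"
    using a a' b b' c d by (auto simp: P_def walk_in_append)
  have fin_P: "finite P" by (simp add: P_def)
  have P: "\<And>p. p \<in> P \<Longrightarrow> st_path B p" by (simp add: P_def)
  have card_P: "card (P - {a @ c, d @ b}) + 2 = k"
    using in_P neq fin_P card_mono[OF fin_P, of "{a @ c, d @ b}"]
    by (simp add: k_def card_Diff_subset)
  define Q where "Q = a @ M @ b"
  have Q: "st_path (arcs G) Q"
    unfolding Q_def walk_in_append using walk_in_mono[OF a B_arcs] walk_in_mono[OF b B_arcs] M
    by blast
  define X where "X = paths_flow P"
  \<comment> \<open>With a factor \<open>m\<close> instead of \<open>k\<close>, lightness of all
    paths requires \<open>(m + 1) * (k - 1) < m * k + 1\<close>, that is \<open>k < m + 2\<close>;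
    the choice \<open>m = k\<close> satisfies this and also gives \<open>X \<le> Y\<close>.\<close>
  define Y where "Y e = int k * X e + path_flow Q e" for e
  have X: "nonneg_flow G s t X" and val_X: "flow_value G s X = int k"
    unfolding X_def k_def using nonneg_flow_paths_flow[OF P] by simp_all
  have "supp X = (\<Union>p \<in> P. set p)"
    unfolding X_def
  proof (rule supp_paths_flow[OF fin_P])
    fix p assume "p \<in> P"
    with walk_in_subset[OF P] B_arcs show "set p \<subseteq> arcs G" by blast
  qed
  moreover have "(\<Union>p \<in> P. set p) = B"
  proof (intro equalityI subsetI)
    fix e assume "e \<in> B"
    from saturated_st_path[OF sat this] show "e \<in> (\<Union>p \<in> P. set p)" unfolding P_def by blast
  next
    fix e assume "e \<in> (\<Union>p \<in> P. set p)"
    then show "e \<in> B" using walk_in_subset[OF P] by blast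
  qed
  ultimately have supp_X: "supp X = B" and P_B: "(\<Union>p \<in> P. set p) = B" by simp_all
  have bal_Y: "balance Y x = int k * balance X x + (of_bool (s = x) - of_bool (t = x))" for x
    using balance_add[of "\<lambda>e. int k * X e" "path_flow Q" x] balance_scale[of "int k" X x]
      balance_path_flow[OF Q, of x] by (simp add: Y_def[abs_def])
  have Y: "nonneg_flow G s t Y"
    using X bal_Y by (auto simp: nonneg_flow_def flow_iff_balance Y_def path_flow_def)
  have val_Y: "flow_value G s Y = int k * int k + 1"
    using bal_Y[of s] s_neq_t val_X by (simp add: flow_value_eq_balance)
  have "2 \<le> k" using card_P by simp
  have supp_Y: "supp Y = B \<union> set Q"
  proof -
    have "Y e \<noteq> 0 \<longleftrightarrow> X e \<noteq> 0 \<or> e \<in> set Q" if "e \<in> arcs G" for e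
    proof -
      have "0 \<le> int k * X e" by (simp add: X_def)
      then show ?thesis using \<open>2 \<le> k\<close> by (auto simp: Y_def path_flow_def)
    qed
    then show ?thesis using supp_X walk_in_subset[OF Q] by (auto simp: supp_def)
  qed
  have le: "X e \<le> Y e" if "e \<in> arcs G" for e
  proof -
    have "1 * X e \<le> int k * X e" using \<open>2 \<le> k\<close> by (intro mult_right_mono) (auto simp: X_def)
    then show ?thesis by (simp add: Y_def path_flow_def)
  qed
  have cover: "cover (supp Y) (insert Q (P - {a @ c, d @ b}))"
    unfolding cover_def
  proof (intro conjI ballI subsetI)
    fix p assume "p \<in> insert Q (P - {a @ c, d @ b})"
    then show "st_path (supp Y) p"
      using walk_in_mono[OF P, of p "supp Y"] walk_in_restrict[OF Q, of "supp Y"] supp_Y by auto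
  next
    fix x assume "x \<in> supp Y"
    then consider "x \<in> set Q" | p where "p \<in> P" "x \<in> set p" using supp_Y P_B by blast
    then show "x \<in> (\<Union>p \<in> insert Q (P - {a @ c, d @ b}). set p)"
    proof cases
      case 2
      have "a' @ c \<in> P - {a @ c, d @ b}" "d @ b' \<in> P - {a @ c, d @ b}"
        using in_P neq \<open>a \<noteq> a'\<close> \<open>b \<noteq> b'\<close> by auto
      moreover have "x \<in> set Q \<or> x \<in> set (a' @ c) \<or> x \<in> set (d @ b')" if "p \<in> {a @ c, d @ b}"
        using that 2 by (auto simp: Q_def)
      ultimately show ?thesis using 2 by blast
    qed simp
  qed (simp add: fin_P)
  have width_Y: "width (flow_support G Y) s t + 1 \<le> k"
    using width_le_card[OF cover] card_P fin_P by (simp add: card_insert_if split: if_splits)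
  \<comment> \<open>The private arcs serve twice: they are an antichain of size \<open>k\<close>,
    which bounds the width of \<open>X\<close> from below, and they are arcs on which
    \<open>X\<close> equals 1.\<close>
  obtain r where r: "\<And>p. p \<in> P \<Longrightarrow> r p \<in> set p"
    "\<And>p q. p \<in> P \<Longrightarrow> q \<in> P \<Longrightarrow> r p \<in> set q \<Longrightarrow> q = p"
  proof -
    have "\<exists>e. e \<in> set p \<and> (\<forall>q \<in> P. e \<in> set q \<longrightarrow> q = p)" if "p \<in> P" for p
      using priv that unfolding P_def private_arcs_def by blast
    then obtain r where "\<forall>p \<in> P. r p \<in> set p \<and> (\<forall>q \<in> P. r p \<in> set q \<longrightarrow> q = p)" by metis
    with that[of r] show thesis by blast
  qed
  have "inj_on r P" using r unfolding inj_on_def by metis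
  have width_X: "k \<le> width (flow_support G X) s t"
  proof -
    have "card (r ` P) \<le> width (flow_support G X) s t"
    proof (rule card_le_width[OF X])
      show "r ` P \<subseteq> supp X" using r(1) supp_X P_B by blast
      fix p x x' assume "st_path (supp X) p" and x: "x \<in> r ` P \<inter> set p" "x' \<in> r ` P \<inter> set p"
      then have "p \<in> P" using supp_X by (simp add: P_def)
      with x r(2) show "x = x'" by blast
    qed
    then show ?thesis using card_image[OF \<open>inj_on r P\<close>] by (simp add: k_def)
  qed
  have "supp Y \<noteq> {}" using supp_Y e(1) by blast
  then have nonzero: "\<exists>e \<in> arcs G. Y e \<noteq> 0" by (auto simp: supp_def)
  define w where "w = width (flow_support G Y) s t"
  have "0 < w"
    using width_attained[OF Y] \<open>supp Y \<noteq> {}\<close> unfolding w_def cover_def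
    by (metis UN_empty card_gt_0_iff subset_empty)
  have light: "\<not> carries Y p (real_of_int (flow_value G s Y) / real w)" if p: "st_path (supp Y) p" for p
  proof -
    \<comment> \<open>A path inside \<open>B\<close> is a funnel path and contains its private arc;
      any other path uses an arc of \<open>Q\<close> outside \<open>B\<close>, where
      \<open>X\<close> vanishes.\<close>
    have "\<exists>x \<in> set p. Y x \<le> int k + 1"
    proof (cases "set p \<subseteq> B")
      case True
      with p have "p \<in> P" unfolding P_def using walk_in_restrict by blast
      have "X (r p) = (\<Sum>q \<in> P. of_bool (q = p))"
        unfolding X_def paths_flow_def path_flow_def
      proof (rule sum.cong[OF refl])
        fix q assume "q \<in> P"
        then have "r p \<in> set q \<longleftrightarrow> q = p" using r \<open>p \<in> P\<close> by blast
        then show "of_bool (r p \<in> set q) = (of_bool (q = p) :: int)" by simp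
      qed
      also have "\<dots> = 1" using fin_P \<open>p \<in> P\<close> by (simp add: of_bool_def)
      finally have "Y (r p) \<le> int k + 1" by (simp add: Y_def path_flow_def)
      with r(1)[OF \<open>p \<in> P\<close>] show ?thesis by blast
    next
      case False
      then obtain x where x: "x \<in> set p" "x \<notin> B" by blast
      with walk_in_subset[OF p] have "X x = 0" using supp_X by (auto simp: supp_def)
      then have "Y x \<le> int k + 1" by (simp add: Y_def path_flow_def)
      with x show ?thesis by blast
    qed
    then obtain x where x: "x \<in> set p" "Y x \<le> int k + 1" by blast
    have "real w * (real k + 1) \<le> (real k - 1) * (real k + 1)"
      using width_Y unfolding w_def by (intro mult_right_mono) auto
    also have "\<dots> < real_of_int (flow_value G s Y)"
      by (simp add: val_Y algebra_simps)
    finally have "real k + 1 < real_of_int (flow_value G s Y) / real w"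
      using \<open>0 < w\<close> by (simp add: field_simps)
    moreover have "real_of_int (Y x) \<le> real k + 1" using x(2) by linarith
    ultimately show ?thesis using x(1) unfolding carries_def by force
  qed
  have "width (flow_support G Y) s t < width (flow_support G X) s t"
    using width_X width_Y by linarith
  from that[OF X Y le this nonzero light[unfolded w_def]] show thesis .
qed

lemma width_stable_iff_large_weight_paths_iff_no_central_path:
  "(width_stable G s t \<longleftrightarrow> large_weight_paths G s t) \<and>
   (large_weight_paths G s t \<longleftrightarrow> \<not> (\<exists>F p. funnel_subgraph F G s t \<and> central_path G F p))"
proof -
  have "\<not> large_weight_paths G s t"
    if "funnel_subgraph F G s t" "central_path G F p" for F p
  proof
    assume large: "large_weight_paths G s t"
    from central_path_flows[OF that] obtain Y where Y: "nonneg_flow G s t Y" "\<exists>e \<in> arcs G. Y e \<noteq> 0"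
      "\<And>p. st_path (supp Y) p \<Longrightarrow>
        \<not> carries Y p (real_of_int (flow_value G s Y) / real (width (flow_support G Y) s t))"
      by metis
    with large show False
      unfolding large_weight_paths_def apath_flow_support_iff by blast
  qed
  then show ?thesis
    using no_central_path_imp_width_stable width_stable_imp_large_weight_paths by blast
qed

end

theorem lemma13:
  fixes G :: "('a, 'b) pre_digraph" and s t :: 'a
  assumes "st_dag G s t"
  shows "(width_stable G s t \<longleftrightarrow> large_weight_paths G s t) \<and>
         (large_weight_paths G s t \<longleftrightarrow>
            \<not> (\<exists>F p. funnel_subgraph F G s t \<and> central_path G F p))"
proof -
  interpret st_dag_graph G s t using assms by (rule st_dag_graphI)
  show ?thesis
  proof (cases "s = t")
    case False
    then interpret two_terminal_dag G s t by unfold_locales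
    show ?thesis by (rule width_stable_iff_large_weight_paths_iff_no_central_path)
  next
    case True
    then have empty: "arcs G = {}" by (rule arcs_empty_if_source_eq_sink)
    then have "flow_support G X = flow_support G Y" for X Y
      by (simp add: flow_support_def)
    then have "width_stable G s t"
      unfolding width_stable_def by (metis order_refl)
    moreover have "large_weight_paths G s t"
      using empty by (simp add: large_weight_paths_def)
    moreover have "\<not> central_path G F p" if "funnel_subgraph F G s t" for F p
    proof -
      have "arcs F = {}" using that empty by (auto simp: funnel_subgraph_def subgraph_def)
      then show ?thesis by (simp add: central_path_def merging_def in_degree_def in_arcs_def)
    qed
    ultimately show ?thesis by blast
  qed
qed

end
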